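(* Let $T>0$ and assume that the Initial-Boundary Value Problem $$\partial_t u=\Delta_x u \ \text{on } [0,T]\times\mathcal{D},\qquad u=f \ \text{on } [0,T]\times\partial\mathcal{D},\qquad u(0,\cdot)=f_0 \ \text{on } \mathcal{D}$$ admits a unique solution $u\in\mathcal{C}^{1,2}([0,T]\times\mathcal{D})$, continuous on $[0,T]\times\overline{\mathcal{D}}$, given by $$u(t,x)=\mathbb{E}_{(t,x)}[f(T_\infty,X_\infty)1_{\{X_\infty\in\partial\mathcal{D}\}}]+\mathbb{E}_{(t,x)}[f_0(X_\infty)1_{\{X_\infty\notin\partial\mathcal{D}\}}].$$ For $\varepsilon>0$ let $$u^\varepsilon(t,x)=\mathbb{E}_{(t,x)}[f(T_\varepsilon,X_\varepsilon)1_{\{X_\varepsilon\in\partial\mathcal{D}\}}]+\mathbb{E}_{(t,x)}[f_0(X_\varepsilon)1_{\{X_\varepsilon\notin\partial\mathcal{D}\}}],\quad (t,x)\in[0,T]\times\overline{\mathcal{D}}.$$ Then $u^\varepsilon$ converges to $u$ as $\varepsilon\to0$, uniformly with respect to $(t,x)$. Moreover there exist $\kappa_{T,\mathcal{D}}(u)>0$ and $\varepsilon_0>0$ such that $$|u(t,x)-u^\varepsilon(t,x)|\le\kappa_{T,\mathcal{D}}(u)\sqrt{\varepsilon},\quad\forall\,\varepsilon\le\varepsilon_0,\ \forall (t,x)\in[0,T]\times\mathcal{D}.$$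
   Context: $\mathcal{D}\subset\mathbb{R}^d$ is a bounded finitely connected domain, $\delta(\cdot,\partial\mathcal{D})$ is the Euclidean distance to its boundary. $f$ is continuous on $\mathbb{R}_+\times\partial\mathcal{D}$, $f_0$ is continuous on $\mathcal{D}$ and they are compatible: $f(0,x)=f_0(x)$ for $x\in\partial\mathcal{D}$ (i.e. $f_0$ extends continuously to $\overline{\mathcal{D}}$ by $f(0,\cdot)$). Random walk on heat balls: put $\alpha(u,v)=\min\big(u,\frac{e}{2d}\delta^2(v,\partial\mathcal{D})\big)$ and $\psi_d(s)=\sqrt{s\log(s^{-d/2})}$ for $s\in]0,1[$ (with $\psi_d(0)=\psi_d(1)=0$). Let $(U_n)_{n\ge1}$ be i.i.d. uniform random vectors on $[0,1]^{\lfloor d/2\rfloor+1}$, $\Pi_n^U$ the product of the coordinates of $U_n$, $(G_n)_{n\ge1}$ i.i.d. standard Gaussian real random variables, $(V_n)_{n\ge1}$ i.i.d. uniform random vectors on the unit sphere of $\mathbb{R}^d$, the three sequences being independent. Set $R_n=(\Pi_n^U)^{2/d}\exp\{-(1-\frac2d\lfloor\frac d2\rfloor)G_n^2\}$. Under $\mathbb{P}_{(t,x)}$, $(T_0,X_0)=(t,x)$ and, for $n\ge0$, $$T_{n+1}=T_n-\alpha(T_n,X_n)R_{n+1},\qquad X_{n+1}=X_n+2\sqrt{\alpha(T_n,X_n)}\,\psi_d(R_{n+1})V_{n+1}.$$ $(T_\infty,X_\infty)$ denotes the almost sure limit of $(T_n,X_n)$ as $n\to\infty$. Stopping rule: $\mathcal{N}_\varepsilon=\inf\{n\ge0:\alpha(T_n,X_n)\le\varepsilon\}$.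 If $\delta^2(X_{\mathcal{N}_\varepsilon},\partial\mathcal{D})\le\frac{2\varepsilon d}{e}$, choose $X_\varepsilon\in\partial\mathcal{D}$ (measurably) with $\|X_{\mathcal{N}_\varepsilon}-X_\varepsilon\|=\delta(X_{\mathcal{N}_\varepsilon},\partial\mathcal{D})$ and set $T_\varepsilon=T_{\mathcal{N}_\varepsilon}$. If $\delta^2(X_{\mathcal{N}_\varepsilon},\partial\mathcal{D})>\frac{2\varepsilon d}{e}$, set $T_\varepsilon=0$ and $X_\varepsilon=X_{\mathcal{N}_\varepsilon}$.
   Formalization: The √ε rate is proved under the added assumption that ∂_t u and the first-order spatial derivatives of u are bounded on [0,T]×D; without such control it fails (d=1, D=(0,1), f=0, f_0=√(x(1−x)), t=0). Uniform convergence needs no such assumption. *)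

theory Defs
  imports "HOL-Probability.Probability"
begin

section \<open>The initial-boundary value problem for the heat equation\<close>

text \<open>A domain is finitely connected if its complement has finitely many connected components.\<close>

definition bounded_finitely_connected_domain :: "'a::euclidean_space set \<Rightarrow> bool" where
  "bounded_finitely_connected_domain D \<longleftrightarrow>
     open D \<and> connected D \<and> D \<noteq> {} \<and> bounded D \<and> finite (components (- D))"

text \<open>The time derivative is one-sided at the end points of \<open>[0,T]\<close>.\<close>

definition time_deriv :: "real \<Rightarrow> (real \<Rightarrow> 'a \<Rightarrow> real) \<Rightarrow> real \<Rightarrow> 'a \<Rightarrow> real" where
  "time_deriv T u t x = vector_derivative (\<lambda>s. u s x) (at t within {0..T})"

definition space_deriv ::
    "'a::euclidean_space \<Rightarrow> (real \<Rightarrow> 'a \<Rightarrow> real) \<Rightarrow> real \<Rightarrow> 'a \<Rightarrow> real" where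
  "space_deriv i u t x = deriv (\<lambda>h. u t (x + h *\<^sub>R i)) 0"

definition laplacian :: "(real \<Rightarrow> 'a::euclidean_space \<Rightarrow> real) \<Rightarrow> real \<Rightarrow> 'a \<Rightarrow> real" where
  "laplacian u t x = (\<Sum>i\<in>Basis. space_deriv i (space_deriv i u) t x)"

definition C12_on :: "real \<Rightarrow> 'a::euclidean_space set \<Rightarrow> (real \<Rightarrow> 'a \<Rightarrow> real) \<Rightarrow> bool" where
  "C12_on T D u \<longleftrightarrow>
     (\<forall>t\<in>{0..T}. \<forall>x\<in>D.
        (\<lambda>s. u s x) differentiable (at t within {0..T}) \<and>
        (\<forall>i\<in>Basis. (\<lambda>h. u t (x + h *\<^sub>R i)) differentiable (at 0) \<and>
          (\<forall>j\<in>Basis. (\<lambda>h. space_deriv i u t (x + h *\<^sub>R j)) differentiable (at 0)))) \<and>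
     continuous_on ({0..T} \<times> D) (\<lambda>(t, x). u t x) \<and>
     continuous_on ({0..T} \<times> D) (\<lambda>(t, x). time_deriv T u t x) \<and>
     (\<forall>i\<in>Basis. continuous_on ({0..T} \<times> D) (\<lambda>(t, x). space_deriv i u t x) \<and>
       (\<forall>j\<in>Basis. continuous_on ({0..T} \<times> D)
          (\<lambda>(t, x). space_deriv j (space_deriv i u) t x)))"

definition heat_ibvp_solution ::
    "real \<Rightarrow> 'a::euclidean_space set \<Rightarrow> (real \<Rightarrow> 'a \<Rightarrow> real) \<Rightarrow> ('a \<Rightarrow> real) \<Rightarrow>
     (real \<Rightarrow> 'a \<Rightarrow> real) \<Rightarrow> bool" where
  "heat_ibvp_solution T D f f0 u \<longleftrightarrow>
     C12_on T D u \<and>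
     continuous_on ({0..T} \<times> closure D) (\<lambda>(t, x). u t x) \<and>
     (\<forall>t\<in>{0..T}. \<forall>x\<in>D. time_deriv T u t x = laplacian u t x) \<and>
     (\<forall>t\<in>{0..T}. \<forall>x\<in>frontier D. u t x = f t x) \<and>
     (\<forall>x\<in>D. u 0 x = f0 x)"

definition unique_heat_ibvp_solution ::
    "real \<Rightarrow> 'a::euclidean_space set \<Rightarrow> (real \<Rightarrow> 'a \<Rightarrow> real) \<Rightarrow> ('a \<Rightarrow> real) \<Rightarrow>
     (real \<Rightarrow> 'a \<Rightarrow> real) \<Rightarrow> bool" where
  "unique_heat_ibvp_solution T D f f0 u \<longleftrightarrow>
     heat_ibvp_solution T D f f0 u \<and>
     (\<forall>v. heat_ibvp_solution T D f f0 v \<longrightarrow>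
        (\<forall>t\<in>{0..T}. \<forall>x\<in>closure D. v t x = u t x))"

section \<open>The driving random variables\<close>

text \<open>
  The normalized surface measure of the unit sphere is the cone measure: the mass of a Borel set
  \<open>A\<close> of unit vectors is the Lebesgue measure of the cone of all \<open>r *\<^sub>R a\<close> with \<open>a \<in> A\<close> and
  \<open>0 < r \<le> 1\<close>, divided by the measure of the unit ball. Equivalently, it is the image of
  the uniform distribution on the ball under \<open>sgn x = x /\<^sub>R norm x\<close>.
\<close>

definition uniform_sphere :: "'a::euclidean_space measure" where
  "uniform_sphere = distr (uniform_measure lborel (cball 0 1)) borel sgn"

text \<open>
  The sequences start at index \<open>0\<close>: \<open>U n\<close>, \<open>G n\<close>, \<open>V n\<close> are the variables used in the step from
  \<open>n\<close> to \<open>n + 1\<close>. The vectors \<open>U n\<close> and \<open>V n\<close> take their values in the cube and on the sphere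
  everywhere, not only almost surely, so that the walk never leaves the set on which the data of
  the problem are given. Independence of the three sequences, which have
  different types, is independence of the three \<open>\<sigma>\<close>-algebras that they generate.
\<close>

definition heat_walk_noise ::
    "'w measure \<Rightarrow> (nat \<Rightarrow> 'w \<Rightarrow> nat \<Rightarrow> real) \<Rightarrow> (nat \<Rightarrow> 'w \<Rightarrow> real) \<Rightarrow>
     (nat \<Rightarrow> 'w \<Rightarrow> 'a::euclidean_space) \<Rightarrow> bool" where
  "heat_walk_noise M U G V \<longleftrightarrow>
     (let k = DIM('a) div 2 + 1;
          cube = PiE {..<k} (\<lambda>_. {0..1::real});
          C = PiM {..<k} (\<lambda>_. lborel :: real measure)
      in prob_space M \<and>
         prob_space.indep_vars M (\<lambda>_. C) U UNIV \<and>
         (\<forall>n. (\<forall>\<omega>\<in>space M. U n \<omega> \<in> cube) \<and> distr M C (U n) = uniform_measure C cube) \<and>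
         prob_space.indep_vars M (\<lambda>_. borel) G UNIV \<and>
         (\<forall>n. distributed M lborel (G n) std_normal_density) \<and>
         prob_space.indep_vars M (\<lambda>_. borel) V UNIV \<and>
         (\<forall>n. (\<forall>\<omega>\<in>space M. V n \<omega> \<in> sphere 0 1) \<and> distr M borel (V n) = uniform_sphere) \<and>
         prob_space.indep_sets M
           (\<lambda>j. [sets (vimage_algebra (space M) (\<lambda>\<omega> n. U n \<omega>) (PiM UNIV (\<lambda>_. C))),
                 sets (vimage_algebra (space M) (\<lambda>\<omega> n. G n \<omega>) (PiM UNIV (\<lambda>_. borel))),
                 sets (vimage_algebra (space M) (\<lambda>\<omega> n. V n \<omega>) (PiM UNIV (\<lambda>_. borel)))] ! j)
           {..<3})"

section \<open>The random walk on heat balls\<close>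

definition heat_alpha :: "'a::euclidean_space set \<Rightarrow> real \<Rightarrow> 'a \<Rightarrow> real" where
  "heat_alpha D t x = min t (exp 1 / (2 * real DIM('a)) * (infdist x (frontier D))\<^sup>2)"

definition heat_psi :: "nat \<Rightarrow> real \<Rightarrow> real" where
  "heat_psi d s = (if 0 < s \<and> s < 1 then sqrt (s * ln (s powr (- (real d / 2)))) else 0)"

definition heat_R :: "nat \<Rightarrow> (nat \<Rightarrow> real) \<Rightarrow> real \<Rightarrow> real" where
  "heat_R d y g =
     (\<Prod>i<d div 2 + 1. y i) powr (2 / real d) *
     exp (- (1 - 2 / real d * real (d div 2)) * g\<^sup>2)"

text \<open>
  All starting points \<open>(t, x)\<close> share the noise, so the expectation under
  the law of the walk started at \<open>(t, x)\<close> is an integral with respect to \<open>M\<close>.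
\<close>

primrec heat_walk ::
    "'a::euclidean_space set \<Rightarrow> (nat \<Rightarrow> 'w \<Rightarrow> nat \<Rightarrow> real) \<Rightarrow> (nat \<Rightarrow> 'w \<Rightarrow> real) \<Rightarrow>
     (nat \<Rightarrow> 'w \<Rightarrow> 'a) \<Rightarrow> real \<Rightarrow> 'a \<Rightarrow> 'w \<Rightarrow> nat \<Rightarrow> real \<times> 'a" where
  "heat_walk D U G V t x \<omega> 0 = (t, x)"
| "heat_walk D U G V t x \<omega> (Suc n) =
     (let (s, y) = heat_walk D U G V t x \<omega> n;
          a = heat_alpha D s y;
          r = heat_R DIM('a) (U n \<omega>) (G n \<omega>)
      in (s - a * r, y + (2 * sqrt a * heat_psi DIM('a) r) *\<^sub>R V n \<omega>))"

definition walk_T where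
  "walk_T D U G V t x n \<omega> = fst (heat_walk D U G V t x \<omega> n)"

definition walk_X where
  "walk_X D U G V t x n \<omega> = snd (heat_walk D U G V t x \<omega> n)"

text \<open>The value of \<^term>\<open>lim\<close> off the almost sure event of convergence is irrelevant.\<close>

definition limit_T where
  "limit_T D U G V t x \<omega> = lim (\<lambda>n. walk_T D U G V t x n \<omega>)"

definition limit_X where
  "limit_X D U G V t x \<omega> = lim (\<lambda>n. walk_X D U G V t x n \<omega>)"

section \<open>Stopping rule\<close>

text \<open>The set is nonempty almost surely; on the natural numbers \<^term>\<open>Inf {} = (0::nat)\<close>.\<close>

definition stop_N where
  "stop_N D U G V \<epsilon> t x \<omega> =
     Inf {n. heat_alpha D (walk_T D U G V t x n \<omega>) (walk_X D U G V t x n \<omega>) \<le> \<epsilon>}"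

definition stop_near_boundary ::
    "'a::euclidean_space set \<Rightarrow> (nat \<Rightarrow> 'w \<Rightarrow> nat \<Rightarrow> real) \<Rightarrow> (nat \<Rightarrow> 'w \<Rightarrow> real) \<Rightarrow>
     (nat \<Rightarrow> 'w \<Rightarrow> 'a) \<Rightarrow> real \<Rightarrow> real \<Rightarrow> 'a \<Rightarrow> 'w \<Rightarrow> bool" where
  "stop_near_boundary D U G V \<epsilon> t x \<omega> \<longleftrightarrow>
     (infdist (walk_X D U G V t x (stop_N D U G V \<epsilon> t x \<omega>) \<omega>) (frontier D))\<^sup>2
       \<le> 2 * \<epsilon> * real DIM('a) / exp 1"

definition stop_T where
  "stop_T D U G V \<epsilon> t x \<omega> =
     (if stop_near_boundary D U G V \<epsilon> t x \<omega>
      then walk_T D U G V t x (stop_N D U G V \<epsilon> t x \<omega>) \<omega> else 0)"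

text \<open>
  The nearest boundary point need not be unique, so the final position is not a function of the
  walk: every random variable that satisfies the following predicate is admissible.
\<close>

definition is_stop_X ::
    "'w measure \<Rightarrow> 'a::euclidean_space set \<Rightarrow> (nat \<Rightarrow> 'w \<Rightarrow> nat \<Rightarrow> real) \<Rightarrow>
     (nat \<Rightarrow> 'w \<Rightarrow> real) \<Rightarrow> (nat \<Rightarrow> 'w \<Rightarrow> 'a) \<Rightarrow> real \<Rightarrow> real \<Rightarrow> 'a \<Rightarrow> ('w \<Rightarrow> 'a) \<Rightarrow> bool" where
  "is_stop_X M D U G V \<epsilon> t x Y \<longleftrightarrow>
     Y \<in> borel_measurable M \<and>
     (\<forall>\<omega>\<in>space M.
        let y = walk_X D U G V t x (stop_N D U G V \<epsilon> t x \<omega>) \<omega>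
        in if stop_near_boundary D U G V \<epsilon> t x \<omega>
           then Y \<omega> \<in> frontier D \<and> dist y (Y \<omega>) = infdist y (frontier D)
           else Y \<omega> = y)"

definition expected_data ::
    "'w measure \<Rightarrow> 'a::euclidean_space set \<Rightarrow> (real \<Rightarrow> 'a \<Rightarrow> real) \<Rightarrow> ('a \<Rightarrow> real) \<Rightarrow>
     ('w \<Rightarrow> real) \<Rightarrow> ('w \<Rightarrow> 'a) \<Rightarrow> real" where
  "expected_data M D f f0 S Y =
     (\<integral>\<omega>. f (S \<omega>) (Y \<omega>) * indicator (frontier D) (Y \<omega>) \<partial>M) +
     (\<integral>\<omega>. f0 (Y \<omega>) * indicator (- frontier D) (Y \<omega>) \<partial>M)"

end

theory Submission
  imports Defs
begin

text \<open>
  The noise is i.i.d., so the representation of \<open>u\<close> by the limit of the walk and the Markov property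
  at time 1 give \<open>u(t,x) = E u(T\<^sub>1, X\<^sub>1)\<close>; no mean value theorem for the heat equation is needed.
  A walk frozen in \<open>{\<alpha> \<le> \<epsilon>}\<close> has the same property, and dominated convergence yields
  \<open>u(t,x) = E u(T\<^sub>N, X\<^sub>N)\<close> because \<open>N\<close> is almost surely finite: otherwise
  \<open>T\<^sub>n \<le> t - \<epsilon> \<Sum> R\<^sub>k\<close> for all \<open>n\<close>, while \<open>\<Sum> R\<^sub>k\<close> diverges. It remains to compare
  \<open>u(T\<^sub>N, X\<^sub>N)\<close> with the datum used instead, which equals \<open>u\<close> at distance \<open>O(\<surd>\<epsilon>)\<close> in space
  or \<open>O(\<epsilon>)\<close> in time. Uniform continuity of \<open>u\<close> gives the convergence. Under bounded
  derivatives the mean value theorem gives the rate, since the open ball around \<open>X\<^sub>N\<close> up to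
  the nearest boundary point stays in the domain.
\<close>

section \<open>Independent noise streams\<close>

text \<open>The hypotheses describe three streams of different types, independent of one another,
  whereas the Markov property concerns a single stream of triples \<open>(U n, G n, V n)\<close>.
  The product measure computations pass from one to the other. Their result is that the first triple
  and the stream of later triples have as joint law the product of the law of a triple and the law
  of the whole stream. The second obstacle is partial knowledge. The solution is controlled only on
  \<open>{0..T} \<times> closure D\<close>, and the walk's position need not converge at every
  sample point, although \<open>lim\<close> always returns a value. Hence the data are extended to
  bounded Borel functions, the closed cylinder is shown to be invariant for every sample point, and
  the default value of \<open>lim\<close> is carried along. The convergence of the walk itself then
  never has to be established.\<close>

lemma distr_pair_interchange:
  assumes "sigma_finite_measure A" "sigma_finite_measure B"
    and "sigma_finite_measure C" "sigma_finite_measure D"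
  shows "distr ((A \<Otimes>\<^sub>M B) \<Otimes>\<^sub>M (C \<Otimes>\<^sub>M D)) ((A \<Otimes>\<^sub>M C) \<Otimes>\<^sub>M (B \<Otimes>\<^sub>M D))
           (\<lambda>z. ((fst (fst z), fst (snd z)), (snd (fst z), snd (snd z)))) = (A \<Otimes>\<^sub>M C) \<Otimes>\<^sub>M (B \<Otimes>\<^sub>M D)"
    (is "distr ?L ?R ?f = ?R")
proof -
  interpret A: sigma_finite_measure A by fact
  interpret B: sigma_finite_measure B by fact
  interpret C: sigma_finite_measure C by fact
  interpret D: sigma_finite_measure D by fact
  interpret CB: pair_sigma_finite C B ..
  interpret CD: pair_sigma_finite C D ..
  interpret BD: pair_sigma_finite B D ..
  have sf: "sigma_finite_measure (C \<Otimes>\<^sub>M D)" "sigma_finite_measure (B \<Otimes>\<^sub>M D)" ..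
  show ?thesis
  proof (rule measure_eqI)
    fix X assume "X \<in> sets (distr ?L ?R ?f)"
    then have X [measurable]: "X \<in> sets ?R" by simp
    have f [measurable]: "?f \<in> ?L \<rightarrow>\<^sub>M ?R" by measurable
    define h :: "_ \<Rightarrow> ennreal" where "h = indicator X"
    have h [measurable]: "h \<in> borel_measurable ?R" unfolding h_def by measurable
    have hf: "(\<lambda>z. h (?f z)) \<in> borel_measurable ?L" by measurable
    have inner: "(\<integral>\<^sup>+b. \<integral>\<^sup>+q. h (?f ((a, b), q)) \<partial>(C \<Otimes>\<^sub>M D) \<partial>B) =
        (\<integral>\<^sup>+c. \<integral>\<^sup>+q. h ((a, c), q) \<partial>(B \<Otimes>\<^sub>M D) \<partial>C)" if a: "a \<in> space A" for a
    proof -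
      have a1: "(\<lambda>_. a) \<in> N \<rightarrow>\<^sub>M A" for N :: "'x measure" using a by simp
      have "(\<integral>\<^sup>+b. \<integral>\<^sup>+q. h (?f ((a, b), q)) \<partial>(C \<Otimes>\<^sub>M D) \<partial>B) =
          (\<integral>\<^sup>+b. \<integral>\<^sup>+c. \<integral>\<^sup>+d. h ((a, c), (b, d)) \<partial>D \<partial>C \<partial>B)"
      proof (rule nn_integral_cong)
        fix b assume b: "b \<in> space B"
        have "(\<lambda>q. ((a, fst q), (b, snd q))) \<in> C \<Otimes>\<^sub>M D \<rightarrow>\<^sub>M ?R"
          using a b by (intro measurable_Pair measurable_const measurable_fst measurable_snd) auto
        from measurable_compose[OF this h]
        have "(\<lambda>q. h (?f ((a, b), q))) \<in> borel_measurable (C \<Otimes>\<^sub>M D)" by simp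
        from D.nn_integral_fst[OF this]
        show "(\<integral>\<^sup>+q. h (?f ((a, b), q)) \<partial>(C \<Otimes>\<^sub>M D)) = (\<integral>\<^sup>+c. \<integral>\<^sup>+d. h ((a, c), (b, d)) \<partial>D \<partial>C)"
          by simp
      qed
      \<comment> \<open>The interchange reduces to this: with \<open>a\<close> fixed, the two
        iterated integrals differ only in the order of \<open>b\<close> and \<open>c\<close>, and
        Tonelli exchanges them.\<close>
      also have "\<dots> = (\<integral>\<^sup>+c. \<integral>\<^sup>+b. \<integral>\<^sup>+d. h ((a, c), (b, d)) \<partial>D \<partial>B \<partial>C)"
      proof (rule CB.Fubini')
        have "(\<lambda>p. ((a, fst (fst p)), (snd (fst p), snd p))) \<in> (C \<Otimes>\<^sub>M B) \<Otimes>\<^sub>M D \<rightarrow>\<^sub>M ?R"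
          by (intro measurable_Pair a1) measurable
        from measurable_compose[OF this h]
        show "(\<lambda>(c, b). \<integral>\<^sup>+d. h ((a, c), (b, d)) \<partial>D) \<in> borel_measurable (C \<Otimes>\<^sub>M B)"
          unfolding case_prod_beta
          by (intro D.borel_measurable_nn_integral) (simp add: case_prod_beta)
      qed
      also have "\<dots> = (\<integral>\<^sup>+c. \<integral>\<^sup>+q. h ((a, c), q) \<partial>(B \<Otimes>\<^sub>M D) \<partial>C)"
      proof (rule nn_integral_cong)
        fix c assume c: "c \<in> space C"
        have "(\<lambda>q. ((a, c), q)) \<in> B \<Otimes>\<^sub>M D \<rightarrow>\<^sub>M ?R"
          using a c by (intro measurable_Pair measurable_const measurable_ident) auto
        from measurable_compose[OF this h]
        show "(\<integral>\<^sup>+b. \<integral>\<^sup>+d. h ((a, c), (b, d)) \<partial>D \<partial>B) = (\<integral>\<^sup>+q. h ((a, c), q) \<partial>(B \<Otimes>\<^sub>M D))"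
          by (rule D.nn_integral_fst)
      qed
      finally show ?thesis .
    qed
    have "emeasure (distr ?L ?R ?f) X = (\<integral>\<^sup>+z. h z \<partial>distr ?L ?R ?f)" by (simp add: h_def)
    also have "\<dots> = (\<integral>\<^sup>+z. h (?f z) \<partial>?L)"
      by (rule nn_integral_distr[OF f]) simp
    also have "\<dots> = (\<integral>\<^sup>+p. \<integral>\<^sup>+q. h (?f (p, q)) \<partial>(C \<Otimes>\<^sub>M D) \<partial>(A \<Otimes>\<^sub>M B))"
      by (rule sigma_finite_measure.nn_integral_fst[OF sf(1) hf, symmetric])
    also have "\<dots> = (\<integral>\<^sup>+a. \<integral>\<^sup>+b. \<integral>\<^sup>+q. h (?f ((a, b), q)) \<partial>(C \<Otimes>\<^sub>M D) \<partial>B \<partial>A)"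
      using sigma_finite_measure.borel_measurable_nn_integral_fst[OF sf(1) hf]
      by (rule B.nn_integral_fst[symmetric])
    also have "\<dots> = (\<integral>\<^sup>+a. \<integral>\<^sup>+c. \<integral>\<^sup>+q. h ((a, c), q) \<partial>(B \<Otimes>\<^sub>M D) \<partial>C \<partial>A)"
      by (rule nn_integral_cong) (rule inner)
    also have "\<dots> = (\<integral>\<^sup>+p. \<integral>\<^sup>+q. h (p, q) \<partial>(B \<Otimes>\<^sub>M D) \<partial>(A \<Otimes>\<^sub>M C))"
      using sigma_finite_measure.borel_measurable_nn_integral_fst[OF sf(2) h]
      by (rule C.nn_integral_fst)
    also have "\<dots> = (\<integral>\<^sup>+z. h z \<partial>?R)"
      by (rule sigma_finite_measure.nn_integral_fst[OF sf(2) h])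
    also have "\<dots> = emeasure ?R X" by (simp add: h_def)
    finally show "emeasure (distr ?L ?R ?f) X = emeasure ?R X" .
  qed simp
qed

text \<open>The law of an i.i.d. sequence is an infinite power of \<open>\<mu>\<close>. Prepending
  an independent coordinate reproduces that power (\<open>PiM_iter\<close>), and splitting off the
  head undoes the prepending.\<close>

lemma (in prob_space) distr_iid_split:
  fixes X :: "nat \<Rightarrow> 'a \<Rightarrow> 'b"
  assumes indep: "indep_vars (\<lambda>_. N) X UNIV"
    and law: "\<And>n. distr M N (X n) = \<mu>"
  defines "L \<equiv> distr M (PiM UNIV (\<lambda>_. N)) (\<lambda>\<omega> n. X n \<omega>)"
  shows "distr L (\<mu> \<Otimes>\<^sub>M L) (\<lambda>x. (x 0, \<lambda>n. x (Suc n))) = \<mu> \<Otimes>\<^sub>M L"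
proof -
  have rv [measurable]: "X n \<in> M \<rightarrow>\<^sub>M N" for n
    using indep by (simp add: indep_vars_def)
  have prob: "prob_space \<mu>"
    using prob_space_distr[OF rv[of 0]] law by simp
  have "distr M (PiM UNIV (\<lambda>_. N)) (\<lambda>\<omega> n. X n \<omega>) = PiM UNIV (\<lambda>n. distr M N (X n))"
    using indep_vars_iff_distr_eq_PiM[where I = UNIV and M' = "\<lambda>_. N" and X = X] indep rv by (simp add: restrict_UNIV)
  then have *: "distr M (PiM UNIV (\<lambda>_. N)) (\<lambda>\<omega> n. X n \<omega>) = PiM UNIV (\<lambda>_. \<mu>)"
    by (simp add: law)
  interpret mu: prob_space \<mu> by (rule prob)
  interpret sequence_space \<mu> ..
  have "distr S (\<mu> \<Otimes>\<^sub>M S) (\<lambda>x. (x 0, \<lambda>n. x (Suc n))) =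
      distr (distr (\<mu> \<Otimes>\<^sub>M S) S (\<lambda>(s, \<omega>). case_nat s \<omega>)) (\<mu> \<Otimes>\<^sub>M S) (\<lambda>x. (x 0, \<lambda>n. x (Suc n)))"
    unfolding PiM_iter ..
  also have "\<dots> = distr (\<mu> \<Otimes>\<^sub>M S) (\<mu> \<Otimes>\<^sub>M S) ((\<lambda>x. (x 0, \<lambda>n. x (Suc n))) \<circ> (\<lambda>(s, \<omega>). case_nat s \<omega>))"
  proof (rule distr_distr)
    show "(\<lambda>x. (x 0, \<lambda>n. x (Suc n))) \<in> S \<rightarrow>\<^sub>M \<mu> \<Otimes>\<^sub>M S"
      by (intro measurable_Pair measurable_abs_UNIV) measurable
    show "(\<lambda>(s, \<omega>). case_nat s \<omega>) \<in> \<mu> \<Otimes>\<^sub>M S \<rightarrow>\<^sub>M S"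
      unfolding case_prod_beta'
    proof (rule measurable_abs_UNIV)
      fix n show "(\<lambda>x. case_nat (fst x) (snd x) n) \<in> \<mu> \<Otimes>\<^sub>M S \<rightarrow>\<^sub>M \<mu>"
        by (cases n) auto
    qed
  qed
  also have "\<dots> = distr (\<mu> \<Otimes>\<^sub>M S) (\<mu> \<Otimes>\<^sub>M S) (\<lambda>x. x)"
    by (rule distr_cong) auto
  also have "\<dots> = \<mu> \<Otimes>\<^sub>M S" by (rule distr_id)
  finally show ?thesis unfolding L_def * .
qed

text \<open>Measurable rectangles determine a product of sigma-finite measures. The rectangle
  formula is what independent sigma-algebras deliver, and it makes sense for variables of different
  types.\<close>

lemma (in prob_space) distr_pair_eq_pair_measure:
  assumes X [measurable]: "X \<in> M \<rightarrow>\<^sub>M A" and Y [measurable]: "Y \<in> M \<rightarrow>\<^sub>M B"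
    and indep: "\<And>P Q. P \<in> sets A \<Longrightarrow> Q \<in> sets B \<Longrightarrow>
      prob ((X -` P \<inter> space M) \<inter> (Y -` Q \<inter> space M)) =
      prob (X -` P \<inter> space M) * prob (Y -` Q \<inter> space M)"
  shows "distr M (A \<Otimes>\<^sub>M B) (\<lambda>\<omega>. (X \<omega>, Y \<omega>)) = distr M A X \<Otimes>\<^sub>M distr M B Y"
proof (rule pair_measure_eqI[symmetric])
  show "sigma_finite_measure (distr M A X)" "sigma_finite_measure (distr M B Y)"
    by (simp_all add: prob_space_distr prob_space_imp_sigma_finite)
  fix P Q assume P: "P \<in> sets (distr M A X)" and Q: "Q \<in> sets (distr M B Y)"
  then have [measurable]: "P \<in> sets A" "Q \<in> sets B" by auto
  have "(\<lambda>\<omega>. (X \<omega>, Y \<omega>)) -` (P \<times> Q) \<inter> space M = (X -` P \<inter> space M) \<inter> (Y -` Q \<inter> space M)"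
    by auto
  then show "emeasure (distr M A X) P * emeasure (distr M B Y) Q =
      emeasure (distr M (A \<Otimes>\<^sub>M B) (\<lambda>\<omega>. (X \<omega>, Y \<omega>))) (P \<times> Q)"
    using P Q by (simp add: emeasure_distr emeasure_eq_measure indep ennreal_mult)
qed simp

text \<open>Two applications of the pair case: \<open>X\<close> against \<open>(Y, Z)\<close>, then
  \<open>Y\<close> against \<open>Z\<close>. The first needs independence of \<open>X\<close> from
  the sigma-algebra generated jointly by \<open>Y\<close> and \<open>Z\<close>, not merely from each
  of them.\<close>

lemma (in prob_space) distr_triple_eq_pair_measure:
  assumes X [measurable]: "X \<in> M \<rightarrow>\<^sub>M A" and Y [measurable]: "Y \<in> M \<rightarrow>\<^sub>M B"
    and Z [measurable]: "Z \<in> M \<rightarrow>\<^sub>M C"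
    and indep: "indep_sets (\<lambda>j. [sets (vimage_algebra (space M) X A),
      sets (vimage_algebra (space M) Y B), sets (vimage_algebra (space M) Z C)] ! j) {..<3::nat}"
  shows "distr M (A \<Otimes>\<^sub>M (B \<Otimes>\<^sub>M C)) (\<lambda>\<omega>. (X \<omega>, Y \<omega>, Z \<omega>)) =
         distr M A X \<Otimes>\<^sub>M (distr M B Y \<Otimes>\<^sub>M distr M C Z)"
proof -
  define E where "E j = [sets (vimage_algebra (space M) X A),
      sets (vimage_algebra (space M) Y B), sets (vimage_algebra (space M) Z C)] ! j" for j
  \<comment> \<open>Index groups for the first application: \<open>True\<close> selects
    \<open>X\<close>, \<open>False\<close> selects \<open>Y\<close> and \<open>Z\<close>. The
    sigma-algebras generated by disjoint groups of intersection-stable families stay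
    independent.\<close>
  let ?I = "\<lambda>b. if b then {0::nat} else {1, 2}"
  have sp: "X \<in> space M \<rightarrow> space A" "Y \<in> space M \<rightarrow> space B" "Z \<in> space M \<rightarrow> space C"
    using X Y Z by (auto simp: measurable_def)
  have E0: "E 0 = {X -` S \<inter> space M |S. S \<in> sets A}"
    and E1: "E 1 = {Y -` S \<inter> space M |S. S \<in> sets B}"
    and E2: "E 2 = {Z -` S \<inter> space M |S. S \<in> sets C}"
    by (simp_all add: E_def sets_vimage_algebra2 sp numeral_2_eq_2)
  have indep: "indep_sets E {..<3}"
    using indep by (simp add: E_def[abs_def])
  have I_UN: "(\<Union>b\<in>UNIV. ?I b) = {..<3}"
    by (auto simp: UNIV_bool)
  have stable: "Int_stable (E i)" if "i \<in> ?I b" for i b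
    using that by (auto split: if_splits intro: sets.Int_stable simp: E_def)
  have grouped: "indep_sets (\<lambda>b. sigma_sets (space M) (\<Union>i\<in>?I b. E i)) UNIV"
  proof (rule indep_sets_collect_sigma[OF _ stable])
    show "indep_sets E (\<Union>b\<in>UNIV. ?I b)" unfolding I_UN by (rule indep)
    show "disjoint_family ?I" by (auto simp: disjoint_family_on_def)
  qed
  have "distr M (A \<Otimes>\<^sub>M (B \<Otimes>\<^sub>M C)) (\<lambda>\<omega>. (X \<omega>, Y \<omega>, Z \<omega>)) =
      distr M A X \<Otimes>\<^sub>M distr M (B \<Otimes>\<^sub>M C) (\<lambda>\<omega>. (Y \<omega>, Z \<omega>))"
  proof (rule distr_pair_eq_pair_measure)
    fix P Q assume P: "P \<in> sets A" and Q: "Q \<in> sets (B \<Otimes>\<^sub>M C)"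
    let ?N = "sigma (space M) (E 1 \<union> E 2)"
    have sub: "E 1 \<union> E 2 \<subseteq> Pow (space M)"
      unfolding E1 E2 by auto
    have "Y \<in> ?N \<rightarrow>\<^sub>M B" "Z \<in> ?N \<rightarrow>\<^sub>M C"
      using sp sub by (auto simp: measurable_def space_measure_of sets_measure_of E1[simplified] E2
        intro!: sigma_sets.Basic)
    then have "(\<lambda>\<omega>. (Y \<omega>, Z \<omega>)) \<in> ?N \<rightarrow>\<^sub>M B \<Otimes>\<^sub>M C"
      by (rule measurable_Pair)
    from measurable_sets[OF this Q]
    have "(\<lambda>\<omega>. (Y \<omega>, Z \<omega>)) -` Q \<inter> space M \<in> sigma_sets (space M) (\<Union>i\<in>?I False. E i)"
      using sub by (simp add: space_measure_of sets_measure_of)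
    moreover have "X -` P \<inter> space M \<in> sigma_sets (space M) (\<Union>i\<in>?I True. E i)"
      using P by (auto simp: E0 intro!: sigma_sets.Basic)
    ultimately have "prob (\<Inter>b\<in>UNIV. if b then X -` P \<inter> space M else (\<lambda>\<omega>. (Y \<omega>, Z \<omega>)) -` Q \<inter> space M) =
        (\<Prod>b\<in>UNIV. prob (if b then X -` P \<inter> space M else (\<lambda>\<omega>. (Y \<omega>, Z \<omega>)) -` Q \<inter> space M))"
      by (intro indep_setsD[OF grouped]) auto
    then show "prob ((X -` P \<inter> space M) \<inter> ((\<lambda>\<omega>. (Y \<omega>, Z \<omega>)) -` Q \<inter> space M)) =
        prob (X -` P \<inter> space M) * prob ((\<lambda>\<omega>. (Y \<omega>, Z \<omega>)) -` Q \<inter> space M)"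
      by (simp add: UNIV_bool Int_commute mult.commute)
  qed measurable
  also have "distr M (B \<Otimes>\<^sub>M C) (\<lambda>\<omega>. (Y \<omega>, Z \<omega>)) = distr M B Y \<Otimes>\<^sub>M distr M C Z"
  proof (rule distr_pair_eq_pair_measure)
    fix P Q assume P: "P \<in> sets B" and Q: "Q \<in> sets C"
    have "prob (\<Inter>j\<in>{1, 2::nat}. if j = 1 then Y -` P \<inter> space M else Z -` Q \<inter> space M) =
        (\<Prod>j\<in>{1, 2::nat}. prob (if j = 1 then Y -` P \<inter> space M else Z -` Q \<inter> space M))"
      by (rule indep_setsD[OF indep]) (use P Q in \<open>auto simp: E1[simplified] E2 split: if_splits\<close>)
    then show "prob ((Y -` P \<inter> space M) \<inter> (Z -` Q \<inter> space M)) =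
        prob (Y -` P \<inter> space M) * prob (Z -` Q \<inter> space M)"
      by (simp add: Int_commute)
  qed measurable
  finally show ?thesis .
qed

lemma distr_pair_maps:
  assumes "f \<in> A \<rightarrow>\<^sub>M A'" "g \<in> B \<rightarrow>\<^sub>M B'" "distr A A' f = A'" "distr B B' g = B'"
    and "sigma_finite_measure B'"
  shows "distr (A \<Otimes>\<^sub>M B) (A' \<Otimes>\<^sub>M B') (\<lambda>x. (f (fst x), g (snd x))) = A' \<Otimes>\<^sub>M B'"
  using pair_measure_distr[of f A A' g B B'] assms by (simp add: case_prod_beta')

text \<open>Three (head, tail) pairs become one triple of heads and one triple of tails. Interchange
  inside the last two pairs, then once more against the first pair.\<close>

lemma distr_pair_regroup:
  assumes A: "sigma_finite_measure A" and A': "sigma_finite_measure A'"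
    and B: "sigma_finite_measure B" and B': "sigma_finite_measure B'"
    and C: "sigma_finite_measure C" and C': "sigma_finite_measure C'"
  shows "distr ((A \<Otimes>\<^sub>M A') \<Otimes>\<^sub>M ((B \<Otimes>\<^sub>M B') \<Otimes>\<^sub>M (C \<Otimes>\<^sub>M C')))
      ((A \<Otimes>\<^sub>M (B \<Otimes>\<^sub>M C)) \<Otimes>\<^sub>M (A' \<Otimes>\<^sub>M (B' \<Otimes>\<^sub>M C')))
      (\<lambda>p. ((fst (fst p), fst (fst (snd p)), fst (snd (snd p))),
        (snd (fst p), snd (fst (snd p)), snd (snd (snd p))))) =
    (A \<Otimes>\<^sub>M (B \<Otimes>\<^sub>M C)) \<Otimes>\<^sub>M (A' \<Otimes>\<^sub>M (B' \<Otimes>\<^sub>M C'))"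
    (is "distr ?Q1 ?Q3 _ = _")
proof -
  note sfp = sigma_finite_pair_measure
  let ?swap = "\<lambda>z. ((fst (fst z), fst (snd z)), (snd (fst z), snd (snd z)))"
  let ?F2 = "\<lambda>p. (fst p, ?swap (snd p))"
  let ?Q2 = "(A \<Otimes>\<^sub>M A') \<Otimes>\<^sub>M ((B \<Otimes>\<^sub>M C) \<Otimes>\<^sub>M (B' \<Otimes>\<^sub>M C'))"
  have F2: "distr ?Q1 ?Q2 ?F2 = ?Q2"
  proof (rule distr_pair_maps[where f = "\<lambda>x. x" and g = ?swap])
    show "?swap \<in> (B \<Otimes>\<^sub>M B') \<Otimes>\<^sub>M (C \<Otimes>\<^sub>M C') \<rightarrow>\<^sub>M (B \<Otimes>\<^sub>M C) \<Otimes>\<^sub>M (B' \<Otimes>\<^sub>M C')" by measurable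
    show "distr ((B \<Otimes>\<^sub>M B') \<Otimes>\<^sub>M (C \<Otimes>\<^sub>M C')) ((B \<Otimes>\<^sub>M C) \<Otimes>\<^sub>M (B' \<Otimes>\<^sub>M C')) ?swap =
        (B \<Otimes>\<^sub>M C) \<Otimes>\<^sub>M (B' \<Otimes>\<^sub>M C')"
      by (intro distr_pair_interchange assms)
    show "sigma_finite_measure ((B \<Otimes>\<^sub>M C) \<Otimes>\<^sub>M (B' \<Otimes>\<^sub>M C'))" by (intro sfp assms)
  qed (simp_all add: distr_id)
  have "distr ?Q1 ?Q3 (?swap \<circ> ?F2) = distr (distr ?Q1 ?Q2 ?F2) ?Q3 ?swap"
    by (rule distr_distr[symmetric]) measurable
  also have "\<dots> = ?Q3"
    unfolding F2 by (intro distr_pair_interchange sfp assms)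
  finally show ?thesis by (simp add: comp_def)
qed

text \<open>Each stream splits into head and tail with the tail distributed like the whole.
  Independence between the streams makes the joint law a product, in which the heads can be gathered
  apart from the tails; zipping the tails then yields a stream of triples with the original
  law.\<close>

lemma (in prob_space) distr_restart_triple:
  fixes X :: "nat \<Rightarrow> 'a \<Rightarrow> 'b" and Y :: "nat \<Rightarrow> 'a \<Rightarrow> 'c" and W :: "nat \<Rightarrow> 'a \<Rightarrow> 'd"
  assumes X: "indep_vars (\<lambda>_. A) X UNIV" "\<And>n. distr M A (X n) = \<mu>X"
    and Y: "indep_vars (\<lambda>_. B) Y UNIV" "\<And>n. distr M B (Y n) = \<mu>Y"
    and W: "indep_vars (\<lambda>_. C) W UNIV" "\<And>n. distr M C (W n) = \<mu>W"
    and indep: "indep_sets (\<lambda>j.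
       [sets (vimage_algebra (space M) (\<lambda>\<omega> n. X n \<omega>) (PiM UNIV (\<lambda>_. A))),
        sets (vimage_algebra (space M) (\<lambda>\<omega> n. Y n \<omega>) (PiM UNIV (\<lambda>_. B))),
        sets (vimage_algebra (space M) (\<lambda>\<omega> n. W n \<omega>) (PiM UNIV (\<lambda>_. C)))] ! j) {..<3::nat}"
  defines "S \<equiv> A \<Otimes>\<^sub>M (B \<Otimes>\<^sub>M C)"
  shows "distr M (S \<Otimes>\<^sub>M PiM UNIV (\<lambda>_. S))
      (\<lambda>\<omega>. ((X 0 \<omega>, Y 0 \<omega>, W 0 \<omega>), \<lambda>n. (X (Suc n) \<omega>, Y (Suc n) \<omega>, W (Suc n) \<omega>))) =
    distr M S (\<lambda>\<omega>. (X 0 \<omega>, Y 0 \<omega>, W 0 \<omega>)) \<Otimes>\<^sub>M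
    distr M (PiM UNIV (\<lambda>_. S)) (\<lambda>\<omega> n. (X n \<omega>, Y n \<omega>, W n \<omega>))"
proof -
  have rv [measurable]: "X n \<in> M \<rightarrow>\<^sub>M A" "Y n \<in> M \<rightarrow>\<^sub>M B" "W n \<in> M \<rightarrow>\<^sub>M C" for n
    using X Y W by (simp_all add: indep_vars_def)
  define LX where "LX = distr M (PiM UNIV (\<lambda>_. A)) (\<lambda>\<omega> n. X n \<omega>)"
  define LY where "LY = distr M (PiM UNIV (\<lambda>_. B)) (\<lambda>\<omega> n. Y n \<omega>)"
  define LW where "LW = distr M (PiM UNIV (\<lambda>_. C)) (\<lambda>\<omega> n. W n \<omega>)"
  have s [measurable_cong]: "sets LX = sets (PiM UNIV (\<lambda>_. A))" "sets LY = sets (PiM UNIV (\<lambda>_. B))"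
    "sets LW = sets (PiM UNIV (\<lambda>_. C))" "sets \<mu>X = sets A" "sets \<mu>Y = sets B" "sets \<mu>W = sets C"
    unfolding LX_def LY_def LW_def X(2)[of 0, symmetric] Y(2)[of 0, symmetric] W(2)[of 0, symmetric]
    by simp_all
  have paths [measurable]: "(\<lambda>\<omega> n. X n \<omega>) \<in> M \<rightarrow>\<^sub>M PiM UNIV (\<lambda>_. A)"
    "(\<lambda>\<omega> n. Y n \<omega>) \<in> M \<rightarrow>\<^sub>M PiM UNIV (\<lambda>_. B)" "(\<lambda>\<omega> n. W n \<omega>) \<in> M \<rightarrow>\<^sub>M PiM UNIV (\<lambda>_. C)"
    by (auto intro!: measurable_abs_UNIV)
  have prob: "prob_space LX" "prob_space LY" "prob_space LW"
    "prob_space \<mu>X" "prob_space \<mu>Y" "prob_space \<mu>W"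
    unfolding LX_def LY_def LW_def X(2)[of 0, symmetric] Y(2)[of 0, symmetric] W(2)[of 0, symmetric]
    by (auto intro!: prob_space_distr)
  note sf = prob[THEN prob_space_imp_sigma_finite]
  note sfp = sigma_finite_pair_measure
  have split: "(\<lambda>x. (x 0, \<lambda>n. x (Suc n))) \<in> PiM UNIV (\<lambda>_. N) \<rightarrow>\<^sub>M N \<Otimes>\<^sub>M PiM UNIV (\<lambda>_. N)"
    for N :: "'x measure"
    by (intro measurable_Pair measurable_abs_UNIV) measurable
  have split_m [measurable]:
    "(\<lambda>x. (x 0, \<lambda>n. x (Suc n))) \<in> LX \<rightarrow>\<^sub>M \<mu>X \<Otimes>\<^sub>M LX"
    "(\<lambda>x. (x 0, \<lambda>n. x (Suc n))) \<in> LY \<rightarrow>\<^sub>M \<mu>Y \<Otimes>\<^sub>M LY"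
    "(\<lambda>x. (x 0, \<lambda>n. x (Suc n))) \<in> LW \<rightarrow>\<^sub>M \<mu>W \<Otimes>\<^sub>M LW"
    using split[of A] split[of B] split[of C]
    by (simp_all add: s cong: measurable_cong_sets sets_pair_measure_cong)
  have splits: "distr LX (\<mu>X \<Otimes>\<^sub>M LX) (\<lambda>x. (x 0, \<lambda>n. x (Suc n))) = \<mu>X \<Otimes>\<^sub>M LX"
    "distr LY (\<mu>Y \<Otimes>\<^sub>M LY) (\<lambda>x. (x 0, \<lambda>n. x (Suc n))) = \<mu>Y \<Otimes>\<^sub>M LY"
    "distr LW (\<mu>W \<Otimes>\<^sub>M LW) (\<lambda>x. (x 0, \<lambda>n. x (Suc n))) = \<mu>W \<Otimes>\<^sub>M LW"
    using distr_iid_split[OF X] distr_iid_split[OF Y] distr_iid_split[OF W]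
    unfolding LX_def[symmetric] LY_def[symmetric] LW_def[symmetric] .
  have J: "distr M (LX \<Otimes>\<^sub>M (LY \<Otimes>\<^sub>M LW)) (\<lambda>\<omega>. (\<lambda>n. X n \<omega>, \<lambda>n. Y n \<omega>, \<lambda>n. W n \<omega>)) =
      LX \<Otimes>\<^sub>M (LY \<Otimes>\<^sub>M LW)"
  proof -
    have "distr M (LX \<Otimes>\<^sub>M (LY \<Otimes>\<^sub>M LW)) (\<lambda>\<omega>. (\<lambda>n. X n \<omega>, \<lambda>n. Y n \<omega>, \<lambda>n. W n \<omega>)) =
        distr M (PiM UNIV (\<lambda>_. A) \<Otimes>\<^sub>M (PiM UNIV (\<lambda>_. B) \<Otimes>\<^sub>M PiM UNIV (\<lambda>_. C)))
          (\<lambda>\<omega>. (\<lambda>n. X n \<omega>, \<lambda>n. Y n \<omega>, \<lambda>n. W n \<omega>))"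
      by (intro distr_cong sets_pair_measure_cong s refl)
    then show ?thesis
      using distr_triple_eq_pair_measure[OF paths indep]
      unfolding LX_def[symmetric] LY_def[symmetric] LW_def[symmetric] by simp
  qed
  have law_map: "distr M Q' (\<lambda>\<omega>. g (w \<omega>)) = Q'"
    if "distr M Q w = Q" "w \<in> M \<rightarrow>\<^sub>M Q" "g \<in> Q \<rightarrow>\<^sub>M Q'" "distr Q Q' g = Q'"
    for w :: "'a \<Rightarrow> 'x" and g :: "'x \<Rightarrow> 'y" and Q Q'
    using distr_distr[OF that(3,2)] that by (simp add: comp_def)
  let ?F1 = "\<lambda>p. ((\<lambda>x. (x 0, \<lambda>n. x (Suc n))) (fst p),
      (\<lambda>q. ((\<lambda>x. (x 0, \<lambda>n. x (Suc n))) (fst q), (\<lambda>x. (x 0, \<lambda>n. x (Suc n))) (snd q))) (snd p))"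
  let ?Q1 = "(\<mu>X \<Otimes>\<^sub>M LX) \<Otimes>\<^sub>M ((\<mu>Y \<Otimes>\<^sub>M LY) \<Otimes>\<^sub>M (\<mu>W \<Otimes>\<^sub>M LW))"
  have F1: "distr (LX \<Otimes>\<^sub>M (LY \<Otimes>\<^sub>M LW)) ?Q1 ?F1 = ?Q1"
    by (intro distr_pair_maps splits sfp sf split_m) measurable
  have l1: "distr M ?Q1 (\<lambda>\<omega>. ?F1 (\<lambda>n. X n \<omega>, \<lambda>n. Y n \<omega>, \<lambda>n. W n \<omega>)) = ?Q1"
    by (rule law_map[OF J _ _ F1]) measurable
  let ?P = "\<mu>X \<Otimes>\<^sub>M (\<mu>Y \<Otimes>\<^sub>M \<mu>W)" and ?L = "LX \<Otimes>\<^sub>M (LY \<Otimes>\<^sub>M LW)"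
  let ?F2 = "\<lambda>p. ((fst (fst p), fst (fst (snd p)), fst (snd (snd p))),
    (snd (fst p), snd (fst (snd p)), snd (snd (snd p))))"
  have F2_m: "?F2 \<in> ?Q1 \<rightarrow>\<^sub>M ?P \<Otimes>\<^sub>M ?L"
    by (intro measurable_Pair measurable_compose[OF measurable_fst] measurable_compose[OF measurable_snd]
      measurable_fst measurable_snd)
  have l3: "distr M (?P \<Otimes>\<^sub>M ?L) (\<lambda>\<omega>. ?F2 (?F1 (\<lambda>n. X n \<omega>, \<lambda>n. Y n \<omega>, \<lambda>n. W n \<omega>))) = ?P \<Otimes>\<^sub>M ?L"
    by (rule law_map[OF l1 _ F2_m distr_pair_regroup[OF sf(4,1,5,2,6,3)]]) measurable
  let ?Sq = "PiM UNIV (\<lambda>_. S) :: (nat \<Rightarrow> 'b \<times> 'c \<times> 'd) measure"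
  \<comment> \<open>The three tails form a triple of sequences, while the chain reads a sequence of
    triples. By \<open>J\<close>, zipping pushes the product law to the law of the noise
    stream.\<close>
  let ?zip = "\<lambda>t n. (fst t n, fst (snd t) n, snd (snd t) n)"
  have zip [measurable]: "?zip \<in> ?L \<rightarrow>\<^sub>M ?Sq"
    unfolding S_def by (rule measurable_abs_UNIV) measurable
  let ?B = "distr ?L ?Sq ?zip"
  have "?B = distr (distr M ?L (\<lambda>\<omega>. (\<lambda>n. X n \<omega>, \<lambda>n. Y n \<omega>, \<lambda>n. W n \<omega>))) ?Sq ?zip"
    by (simp only: J)
  also have "\<dots> = distr M ?Sq (\<lambda>\<omega> n. (X n \<omega>, Y n \<omega>, W n \<omega>))"
    by (subst distr_distr) (measurable, simp add: comp_def)
  finally have B: "?B = distr M ?Sq (\<lambda>\<omega> n. (X n \<omega>, Y n \<omega>, W n \<omega>))" .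
  have pB: "prob_space ?B"
    unfolding B by (rule prob_space_distr) (unfold S_def, rule measurable_abs_UNIV, measurable)
  have sets_P [measurable_cong]: "sets ?P = sets S"
    unfolding S_def by (intro sets_pair_measure_cong s)
  have "distr (?P \<Otimes>\<^sub>M ?L) (?P \<Otimes>\<^sub>M ?B) (\<lambda>x. ((\<lambda>x. x) (fst x), ?zip (snd x))) = ?P \<Otimes>\<^sub>M ?B"
    by (rule distr_pair_maps)
      (auto intro!: distr_id prob_space_imp_sigma_finite pB distr_cong)
  from law_map[OF l3 _ _ this]
  have "distr M (?P \<Otimes>\<^sub>M ?B)
      (\<lambda>\<omega>. ((X 0 \<omega>, Y 0 \<omega>, W 0 \<omega>), \<lambda>n. (X (Suc n) \<omega>, Y (Suc n) \<omega>, W (Suc n) \<omega>))) = ?P \<Otimes>\<^sub>M ?B"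
    by simp
  moreover have "sets (?P \<Otimes>\<^sub>M ?B) = sets (S \<Otimes>\<^sub>M ?Sq)"
    by (intro sets_pair_measure_cong sets_P) simp
  then have "distr M (S \<Otimes>\<^sub>M ?Sq)
      (\<lambda>\<omega>. ((X 0 \<omega>, Y 0 \<omega>, W 0 \<omega>), \<lambda>n. (X (Suc n) \<omega>, Y (Suc n) \<omega>, W (Suc n) \<omega>))) =
    distr M (?P \<Otimes>\<^sub>M ?B)
      (\<lambda>\<omega>. ((X 0 \<omega>, Y 0 \<omega>, W 0 \<omega>), \<lambda>n. (X (Suc n) \<omega>, Y (Suc n) \<omega>, W (Suc n) \<omega>)))"
    by (intro distr_cong) auto
  ultimately have eq: "distr M (S \<Otimes>\<^sub>M ?Sq)
      (\<lambda>\<omega>. ((X 0 \<omega>, Y 0 \<omega>, W 0 \<omega>), \<lambda>n. (X (Suc n) \<omega>, Y (Suc n) \<omega>, W (Suc n) \<omega>))) = ?P \<Otimes>\<^sub>M ?B"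
    by simp
  \<comment> \<open>Since \<open>?B\<close> has total mass 1, the first marginal of the product is
    \<open>?P\<close>; this identifies \<open>?P\<close> with the law of the first triple without a
    separate independence argument.\<close>
  have "distr (?P \<Otimes>\<^sub>M ?B) S fst = distr (?P \<Otimes>\<^sub>M ?B) ?P fst"
    by (rule distr_cong) (simp_all add: sets_P)
  also have "\<dots> = ?P"
    by (rule prob_space.distr_pair_fst[OF pB])
  finally have "?P = distr (?P \<Otimes>\<^sub>M ?B) S fst" ..
  also have "\<dots> = distr M S (\<lambda>\<omega>. (X 0 \<omega>, Y 0 \<omega>, W 0 \<omega>))"
    unfolding eq[symmetric]
    by (subst distr_distr)
      (auto simp: comp_def S_def intro!: measurable_Pair measurable_abs_UNIV)
  finally show ?thesis unfolding eq B by simp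
qed

section \<open>Markov chains driven by restarting noise\<close>

primrec chain :: "('s \<Rightarrow> 'z \<Rightarrow> 's) \<Rightarrow> 's \<Rightarrow> (nat \<Rightarrow> 'z) \<Rightarrow> nat \<Rightarrow> 's" where
  "chain \<Phi> p z 0 = p"
| "chain \<Phi> p z (Suc n) = \<Phi> (chain \<Phi> p z n) (z n)"

text \<open>The recursion consumes noise at the end, whereas the Markov property at time 1 removes
  it from the front; this reconciles the two.\<close>

lemma chain_Suc_shift:
  "chain \<Phi> p z (Suc n) = chain \<Phi> (\<Phi> p (z 0)) (\<lambda>k. z (Suc k)) n"
  by (induction n) auto

lemma chain_invariant:
  assumes "p \<in> K" "\<And>n. z n \<in> G" "\<And>q w. q \<in> K \<Longrightarrow> w \<in> G \<Longrightarrow> \<Phi> q w \<in> K"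
  shows "chain \<Phi> p z n \<in> K"
  by (induction n) (use assms in auto)

lemma measurable_chain:
  assumes \<Phi> [measurable]: "case_prod \<Phi> \<in> E \<Otimes>\<^sub>M S \<rightarrow>\<^sub>M E"
  shows "(\<lambda>x. chain \<Phi> (fst x) (snd x) n) \<in> E \<Otimes>\<^sub>M PiM UNIV (\<lambda>_. S) \<rightarrow>\<^sub>M E"
proof (induction n)
  case (Suc n)
  have "(\<lambda>x. (chain \<Phi> (fst x) (snd x) n, snd x n)) \<in> E \<Otimes>\<^sub>M PiM UNIV (\<lambda>_. S) \<rightarrow>\<^sub>M E \<Otimes>\<^sub>M S"
    by (rule measurable_Pair[OF Suc]) measurable
  from measurable_compose[OF this \<Phi>] show ?case by simp
qed simp

section \<open>Freezing a chain in a set\<close>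

definition stop_on :: "'s set \<Rightarrow> ('s \<Rightarrow> 'z \<Rightarrow> 's) \<Rightarrow> 's \<Rightarrow> 'z \<Rightarrow> 's" where
  "stop_on A \<Phi> p z = (if p \<in> A then p else \<Phi> p z)"

lemma chain_stop_on:
  assumes "\<exists>n. chain \<Phi> p z n \<in> A" and "n \<ge> Inf {n. chain \<Phi> p z n \<in> A}"
  shows "chain (stop_on A \<Phi>) p z n = chain \<Phi> p z (Inf {n. chain \<Phi> p z n \<in> A})"
proof -
  let ?N = "Inf {n. chain \<Phi> p z n \<in> A}"
  have in_A: "chain \<Phi> p z ?N \<in> A"
    using Inf_nat_def1[of "{n. chain \<Phi> p z n \<in> A}"] assms(1) by auto
  have before: "chain (stop_on A \<Phi>) p z k = chain \<Phi> p z k" if "k \<le> ?N" for k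
    using that
  proof (induction k)
    case (Suc k)
    then have "chain \<Phi> p z k \<notin> A"
      using cInf_lower[of k "{n. chain \<Phi> p z n \<in> A}"] by fastforce
    with Suc show ?case by (simp add: stop_on_def)
  qed simp
  show ?thesis
    using assms(2)
  proof (induction n rule: dec_induct)
    case (step n)
    then show ?case using in_A by (simp add: stop_on_def)
  qed (simp add: before)
qed

text \<open>The single equation \<open>distr_restart\<close> packs two facts: the first noise is
  independent of the later ones, and the later ones together are distributed like the whole
  sequence. This is the form in which the i.i.d. assumption enters all expectations along the
  chain.\<close>

locale restarting_noise = prob_space M for M :: "'w measure" +
  fixes S :: "'z measure" and Z :: "nat \<Rightarrow> 'w \<Rightarrow> 'z"
  assumes noise_measurable [measurable]: "\<And>n. Z n \<in> M \<rightarrow>\<^sub>M S"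
    and distr_restart: "distr M (S \<Otimes>\<^sub>M PiM UNIV (\<lambda>_. S)) (\<lambda>\<omega>. (Z 0 \<omega>, \<lambda>n. Z (Suc n) \<omega>)) =
      distr M S (Z 0) \<Otimes>\<^sub>M distr M (PiM UNIV (\<lambda>_. S)) (\<lambda>\<omega> n. Z n \<omega>)"
begin

abbreviation "sample \<equiv> (\<lambda>\<omega> n. Z n \<omega>)"

lemma measurable_sample [measurable]: "sample \<in> M \<rightarrow>\<^sub>M PiM UNIV (\<lambda>_. S)"
  by (rule measurable_abs_UNIV) measurable

text \<open>The variable \<open>\<omega>'\<close> acts as an independent copy: after the restart the
  tail may be replaced by a fresh full sequence, and Fubini separates it from the first
  noise.\<close>

lemma integral_restart:
  fixes H :: "'z \<times> (nat \<Rightarrow> 'z) \<Rightarrow> real"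
  assumes H [measurable]: "H \<in> borel_measurable (S \<Otimes>\<^sub>M PiM UNIV (\<lambda>_. S))"
    and bound: "\<And>x. \<bar>H x\<bar> \<le> B"
  shows "(\<integral>\<omega>. H (Z 0 \<omega>, \<lambda>n. Z (Suc n) \<omega>) \<partial>M) = (\<integral>\<omega>. \<integral>\<omega>'. H (Z 0 \<omega>, sample \<omega>') \<partial>M \<partial>M)"
proof -
  let ?Sq = "PiM UNIV (\<lambda>_. S) :: (nat \<Rightarrow> 'z) measure"
  let ?P = "distr M S (Z 0)" and ?Q = "distr M ?Sq sample"
  interpret P: prob_space ?P by (rule prob_space_distr) measurable
  interpret Q: prob_space ?Q by (rule prob_space_distr) measurable
  interpret PQ: pair_prob_space ?P ?Q ..
  have HPQ: "H \<in> borel_measurable (?P \<Otimes>\<^sub>M ?Q)"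
    using H by (simp cong: measurable_cong_sets add: sets_pair_measure_cong[OF sets_distr sets_distr])
  have int: "integrable (?P \<Otimes>\<^sub>M ?Q) H"
    by (rule PQ.integrable_const_bound[where B = B]) (use HPQ bound in auto)
  have shift [measurable]: "(\<lambda>\<omega>. (Z 0 \<omega>, \<lambda>n. Z (Suc n) \<omega>)) \<in> M \<rightarrow>\<^sub>M S \<Otimes>\<^sub>M ?Sq"
    by (intro measurable_Pair measurable_abs_UNIV) measurable
  have "(\<integral>\<omega>. H (Z 0 \<omega>, \<lambda>n. Z (Suc n) \<omega>) \<partial>M) =
      (\<integral>x. H x \<partial>distr M (S \<Otimes>\<^sub>M ?Sq) (\<lambda>\<omega>. (Z 0 \<omega>, \<lambda>n. Z (Suc n) \<omega>)))"
    by (rule integral_distr[symmetric]) measurable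
  also have "\<dots> = (\<integral>x. H x \<partial>(?P \<Otimes>\<^sub>M ?Q))" by (simp only: distr_restart)
  also have "\<dots> = (\<integral>z0. \<integral>z. H (z0, z) \<partial>?Q \<partial>?P)" by (rule PQ.integral_fst'[OF int, symmetric])
  also have "\<dots> = (\<integral>\<omega>. \<integral>z. H (Z 0 \<omega>, z) \<partial>?Q \<partial>M)"
  proof (rule integral_distr)
    show "(\<lambda>z0. \<integral>z. H (z0, z) \<partial>?Q) \<in> borel_measurable S"
      by (rule Q.borel_measurable_lebesgue_integral) (simp add: case_prod_beta')
  qed measurable
  also have "\<dots> = (\<integral>\<omega>. \<integral>\<omega>'. H (Z 0 \<omega>, sample \<omega>') \<partial>M \<partial>M)"
  proof (rule Bochner_Integration.integral_cong[OF refl])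
    fix \<omega> assume "\<omega> \<in> space M"
    then have "Z 0 \<omega> \<in> space S" using noise_measurable by (rule measurable_space[rotated])
    then have "(\<lambda>z. H (Z 0 \<omega>, z)) \<in> borel_measurable ?Sq" by measurable
    then show "(\<integral>z. H (Z 0 \<omega>, z) \<partial>?Q) = (\<integral>\<omega>'. H (Z 0 \<omega>, sample \<omega>') \<partial>M)"
      by (intro integral_distr measurable_sample)
  qed
  finally show ?thesis .
qed

text \<open>A functional of the whole trajectory that is unchanged when the first step is absorbed
  into the starting point has a harmonic expectation. It is applied to the payoff at the limit of
  the walk.\<close>

lemma harmonic_of_shift_invariant:
  fixes L :: "'s \<Rightarrow> (nat \<Rightarrow> 'z) \<Rightarrow> real"
  assumes \<Phi> [measurable]: "case_prod \<Phi> \<in> E \<Otimes>\<^sub>M S \<rightarrow>\<^sub>M E"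
    and L [measurable]: "case_prod L \<in> borel_measurable (E \<Otimes>\<^sub>M PiM UNIV (\<lambda>_. S))"
    and bound: "\<And>q z. \<bar>L q z\<bar> \<le> B"
    and shift: "\<And>q z. L q z = L (\<Phi> q (z 0)) (\<lambda>n. z (Suc n))"
    and p: "p \<in> space E"
  shows "(\<integral>\<omega>. \<integral>\<omega>'. L (\<Phi> p (Z 0 \<omega>)) (sample \<omega>') \<partial>M \<partial>M) = (\<integral>\<omega>. L p (sample \<omega>) \<partial>M)"
proof -
  have p1: "(\<lambda>_. p) \<in> N \<rightarrow>\<^sub>M E" for N :: "'x measure" using p by simp
  have "(\<lambda>x. (\<Phi> p (fst x), snd x)) \<in> S \<Otimes>\<^sub>M PiM UNIV (\<lambda>_. S) \<rightarrow>\<^sub>M E \<Otimes>\<^sub>M PiM UNIV (\<lambda>_. S)"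
    using measurable_compose[OF measurable_Pair[OF p1 measurable_fst] \<Phi>]
    by (intro measurable_Pair) auto
  from measurable_compose[OF this L]
  have "(\<lambda>x. L (\<Phi> p (fst x)) (snd x)) \<in> borel_measurable (S \<Otimes>\<^sub>M PiM UNIV (\<lambda>_. S))" by simp
  from integral_restart[OF this bound]
  have "(\<integral>\<omega>. L (\<Phi> p (Z 0 \<omega>)) (\<lambda>n. Z (Suc n) \<omega>) \<partial>M) =
      (\<integral>\<omega>. \<integral>\<omega>'. L (\<Phi> p (Z 0 \<omega>)) (sample \<omega>') \<partial>M \<partial>M)" by simp
  moreover have "L (\<Phi> p (Z 0 \<omega>)) (\<lambda>n. Z (Suc n) \<omega>) = L p (sample \<omega>)" for \<omega>
    using shift[of p "sample \<omega>"] by simp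
  ultimately show ?thesis by simp
qed

text \<open>The induction peels off the first step, so the hypothesis is used at the random point
  reached after it. The sets \<open>K\<close> and \<open>G\<close> keep this point where harmonicity
  is known.\<close>

lemma integral_chain_harmonic:
  fixes h :: "'s \<Rightarrow> real"
  assumes \<Phi> [measurable]: "case_prod \<Phi> \<in> E \<Otimes>\<^sub>M S \<rightarrow>\<^sub>M E"
    and h [measurable]: "h \<in> borel_measurable E" and bound: "\<And>q. \<bar>h q\<bar> \<le> B"
    and K: "K \<subseteq> space E" and noise: "\<And>n \<omega>. \<omega> \<in> space M \<Longrightarrow> Z n \<omega> \<in> G"
    and inv: "\<And>q w. q \<in> K \<Longrightarrow> w \<in> G \<Longrightarrow> \<Phi> q w \<in> K"
    and harmonic: "\<And>q. q \<in> K \<Longrightarrow> (\<integral>\<omega>. h (\<Phi> q (Z 0 \<omega>)) \<partial>M) = h q"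
    and p: "p \<in> K"
  shows "(\<integral>\<omega>. h (chain \<Phi> p (sample \<omega>) n) \<partial>M) = h p"
  using p
proof (induction n arbitrary: p)
  case 0
  then show ?case by (simp add: prob_space)
next
  case (Suc n)
  have p1: "(\<lambda>_. p) \<in> N \<rightarrow>\<^sub>M E" for N :: "'x measure" using K Suc.prems by auto
  have "(\<lambda>x. (\<Phi> p (fst x), snd x)) \<in> S \<Otimes>\<^sub>M PiM UNIV (\<lambda>_. S) \<rightarrow>\<^sub>M E \<Otimes>\<^sub>M PiM UNIV (\<lambda>_. S)"
    using measurable_compose[OF measurable_Pair[OF p1 measurable_fst] \<Phi>]
    by (intro measurable_Pair) auto
  from measurable_compose[OF measurable_compose[OF this measurable_chain[OF \<Phi>]] h]
  have "(\<lambda>x. h (chain \<Phi> (\<Phi> p (fst x)) (snd x) n)) \<in> borel_measurable (S \<Otimes>\<^sub>M PiM UNIV (\<lambda>_. S))"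
    by simp
  from integral_restart[OF this bound]
  have "(\<integral>\<omega>. h (chain \<Phi> p (sample \<omega>) (Suc n)) \<partial>M) =
      (\<integral>\<omega>. \<integral>\<omega>'. h (chain \<Phi> (\<Phi> p (Z 0 \<omega>)) (sample \<omega>') n) \<partial>M \<partial>M)"
    unfolding chain_Suc_shift by simp
  also have "\<dots> = (\<integral>\<omega>. h (\<Phi> p (Z 0 \<omega>)) \<partial>M)"
    by (intro Bochner_Integration.integral_cong Suc.IH inv noise Suc.prems) auto
  also have "\<dots> = h p" by (rule harmonic[OF Suc.prems])
  finally show ?case .
qed

lemma integral_chain_stopped:
  fixes h :: "'s \<Rightarrow> real"
  assumes \<Phi> [measurable]: "case_prod \<Phi> \<in> E \<Otimes>\<^sub>M S \<rightarrow>\<^sub>M E"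
    and h [measurable]: "h \<in> borel_measurable E" and bound: "\<And>q. \<bar>h q\<bar> \<le> B"
    and K: "K \<subseteq> space E" and noise: "\<And>n \<omega>. \<omega> \<in> space M \<Longrightarrow> Z n \<omega> \<in> G"
    and inv: "\<And>q w. q \<in> K \<Longrightarrow> w \<in> G \<Longrightarrow> \<Phi> q w \<in> K"
    and harmonic: "\<And>q. q \<in> K \<Longrightarrow> (\<integral>\<omega>. h (\<Phi> q (Z 0 \<omega>)) \<partial>M) = h q"
    and p: "p \<in> K" and A [measurable]: "A \<in> sets E"
    and hits: "AE \<omega> in M. \<exists>n. chain \<Phi> p (sample \<omega>) n \<in> A"
  shows "(\<lambda>\<omega>. chain \<Phi> p (sample \<omega>) (Inf {n. chain \<Phi> p (sample \<omega>) n \<in> A})) \<in> M \<rightarrow>\<^sub>M E"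
    and "(\<integral>\<omega>. h (chain \<Phi> p (sample \<omega>) (Inf {n. chain \<Phi> p (sample \<omega>) n \<in> A})) \<partial>M) = h p"
proof -
  have p1: "(\<lambda>_. p) \<in> N \<rightarrow>\<^sub>M E" for N :: "'x measure" using K p by auto
  have chain_m [measurable]: "(\<lambda>\<omega>. chain \<Psi> p (sample \<omega>) n) \<in> M \<rightarrow>\<^sub>M E"
    if "case_prod \<Psi> \<in> E \<Otimes>\<^sub>M S \<rightarrow>\<^sub>M E" for \<Psi> n
    using measurable_compose[OF measurable_Pair[OF p1 measurable_sample] measurable_chain[OF that]]
    by simp
  let ?N = "\<lambda>\<omega>. Inf {n. chain \<Phi> p (sample \<omega>) n \<in> A}"
  \<comment> \<open>On the naturals \<open>Inf\<close> is a \<open>LEAST\<close>, so measurability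
    of the hitting index reduces to the countably many events that the chain is in \<open>A\<close>
    at time \<open>n\<close>.\<close>
  have [measurable]: "?N \<in> M \<rightarrow>\<^sub>M count_space UNIV"
    unfolding Inf_nat_def mem_Collect_eq by (intro measurable_Least) measurable
  show m [measurable]: "(\<lambda>\<omega>. chain \<Phi> p (sample \<omega>) (?N \<omega>)) \<in> M \<rightarrow>\<^sub>M E"
    by (rule measurable_compose_countable) measurable
  have \<Psi> [measurable]: "case_prod (stop_on A \<Phi>) \<in> E \<Otimes>\<^sub>M S \<rightarrow>\<^sub>M E"
  proof -
    have "(\<lambda>x. if fst x \<in> A then fst x else case_prod \<Phi> x) \<in> E \<Otimes>\<^sub>M S \<rightarrow>\<^sub>M E" by measurable
    then show ?thesis by (simp add: stop_on_def case_prod_beta')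
  qed
  have "(\<lambda>n. \<integral>\<omega>. h (chain (stop_on A \<Phi>) p (sample \<omega>) n) \<partial>M) \<longlonglongrightarrow>
      (\<integral>\<omega>. h (chain \<Phi> p (sample \<omega>) (?N \<omega>)) \<partial>M)"
  proof (rule integral_dominated_convergence[where w = "\<lambda>_. B"])
    show "AE \<omega> in M. (\<lambda>n. h (chain (stop_on A \<Phi>) p (sample \<omega>) n)) \<longlonglongrightarrow>
        h (chain \<Phi> p (sample \<omega>) (?N \<omega>))"
      using hits
    proof eventually_elim
      case (elim \<omega>)
      have "h (chain (stop_on A \<Phi>) p (sample \<omega>) n) = h (chain \<Phi> p (sample \<omega>) (?N \<omega>))"
        if "n \<ge> ?N \<omega>" for n
        using chain_stop_on[OF elim that] by simp
      then show ?case by (intro tendsto_eventually eventually_sequentiallyI)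
    qed
  qed (use bound in auto)
  moreover have "(\<integral>\<omega>. h (chain (stop_on A \<Phi>) p (sample \<omega>) n) \<partial>M) = h p" for n
  proof (rule integral_chain_harmonic[OF \<Psi> h bound K noise _ _ p])
    show "stop_on A \<Phi> q w \<in> K" if "q \<in> K" "w \<in> G" for q w
      using that inv by (simp add: stop_on_def)
    show "(\<integral>\<omega>. h (stop_on A \<Phi> q (Z 0 \<omega>)) \<partial>M) = h q" if "q \<in> K" for q
      using harmonic[OF that] by (cases "q \<in> A") (simp_all add: stop_on_def prob_space)
  qed auto
  ultimately show "(\<integral>\<omega>. h (chain \<Phi> p (sample \<omega>) (?N \<omega>)) \<partial>M) = h p"
    by (simp add: LIMSEQ_const_iff)
qed

text \<open>The Laplace transform of the partial sums decays geometrically.\<close>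

lemma AE_partial_sums_unbounded:
  fixes R :: "'z \<Rightarrow> real"
  assumes R [measurable]: "R \<in> borel_measurable S"
    and nonneg: "\<And>z. 0 \<le> R z"
    and pos: "\<not> (AE \<omega> in M. R (Z 0 \<omega>) = 0)"
  shows "AE \<omega> in M. \<exists>n. c < (\<Sum>k<n. R (Z k \<omega>))"
proof -
  let ?\<rho> = "\<integral>\<omega>. exp (- R (Z 0 \<omega>)) \<partial>M"
  have int0: "integrable M (\<lambda>\<omega>. exp (- R (Z 0 \<omega>)))"
    by (rule integrable_const_bound[where B = 1]) (auto simp: nonneg)
  \<comment> \<open>Equality would give the nonnegative variable \<open>1 - exp (- R)\<close> mean
    zero, hence \<open>R = 0\<close> almost surely, against \<open>pos\<close>.\<close>
  have "?\<rho> \<noteq> 1"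
  proof
    assume "?\<rho> = 1"
    then have "(\<integral>\<omega>. 1 - exp (- R (Z 0 \<omega>)) \<partial>M) = 0" using int0 by (simp add: prob_space)
    then have "AE \<omega> in M. 1 - exp (- R (Z 0 \<omega>)) = 0"
      using int0 by (subst (asm) integral_nonneg_eq_0_iff_AE) (auto simp: nonneg)
    then show False using pos by auto
  qed
  moreover have "?\<rho> \<le> (\<integral>\<omega>. 1 \<partial>M)"
    by (rule integral_mono[OF int0]) (auto simp: nonneg)
  ultimately have \<rho>: "?\<rho> < 1" by (simp add: prob_space)
  have \<rho>0: "0 \<le> ?\<rho>" by (rule integral_nonneg_AE) simp
  have power: "(\<integral>\<omega>. exp (- (\<Sum>k<n. R (Z k \<omega>))) \<partial>M) = ?\<rho> ^ n" for n
  proof (induction n)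
    case 0 show ?case by (simp add: prob_space)
  next
    case (Suc n)
    let ?H = "\<lambda>x. exp (- R (fst x)) * exp (- (\<Sum>k<n. R (snd x k)))"
    have "(\<integral>\<omega>. ?H (Z 0 \<omega>, \<lambda>n. Z (Suc n) \<omega>) \<partial>M) = (\<integral>\<omega>. \<integral>\<omega>'. ?H (Z 0 \<omega>, sample \<omega>') \<partial>M \<partial>M)"
    proof (rule integral_restart[where B = 1])
      show "?H \<in> borel_measurable (S \<Otimes>\<^sub>M PiM UNIV (\<lambda>_. S))" by measurable
      show "\<bar>?H x\<bar> \<le> 1" for x
        using mult_mono[of "exp (- R (fst x))" 1 "exp (- (\<Sum>k<n. R (snd x k)))" 1]
        by (simp add: abs_mult sum_nonneg nonneg)
    qed
    moreover have "exp (- (\<Sum>k<Suc n. R (Z k \<omega>))) = ?H (Z 0 \<omega>, \<lambda>n. Z (Suc n) \<omega>)" for \<omega>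
      unfolding sum.lessThan_Suc_shift by (simp add: exp_add[symmetric])
    ultimately show ?case by (simp add: Suc.IH)
  qed
  let ?A = "{\<omega> \<in> space M. \<forall>n. (\<Sum>k<n. R (Z k \<omega>)) \<le> c}"
  have A [measurable]: "?A \<in> sets M" by measurable
  \<comment> \<open>Chernoff bound: on \<open>?A\<close> every partial sum is at most
    \<open>c\<close>, so \<open>exp (c - sum)\<close> is at least 1 there, for each
    \<open>n\<close>.\<close>
  have "prob ?A \<le> exp c * ?\<rho> ^ n" for n
  proof -
    have "prob ?A = (\<integral>\<omega>. indicator ?A \<omega> \<partial>M)" by simp
    also have "\<dots> \<le> (\<integral>\<omega>. exp c * exp (- (\<Sum>k<n. R (Z k \<omega>))) \<partial>M)"
    proof (rule integral_mono)
      show "integrable M (\<lambda>\<omega>. exp c * exp (- (\<Sum>k<n. R (Z k \<omega>))))"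
        by (intro integrable_mult_right integrable_const_bound[where B = 1])
          (auto simp: sum_nonneg nonneg)
      show "integrable M (indicator ?A :: 'w \<Rightarrow> real)"
        by (rule integrable_const_bound[where B = 1]) (auto simp: indicator_def)
      show "indicator ?A \<omega> \<le> exp c * exp (- (\<Sum>k<n. R (Z k \<omega>)))" for \<omega>
        by (auto simp: indicator_def exp_add[symmetric])
    qed
    also have "\<dots> = exp c * ?\<rho> ^ n" by (simp add: power)
    finally show ?thesis .
  qed
  moreover have lim: "(\<lambda>n. exp c * ?\<rho> ^ n) \<longlonglongrightarrow> exp c * 0"
    by (intro tendsto_mult_left LIMSEQ_realpow_zero \<rho> \<rho>0)
  ultimately have "prob ?A \<le> exp c * 0"
    by (intro LIMSEQ_le_const[OF lim]) blast
  then have "prob ?A = 0" by (simp add: measure_le_0_iff)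
  then have "AE \<omega> in M. \<omega> \<notin> ?A"
    by (simp add: prob_eq_0)
  then show ?thesis
    by (rule AE_mp) (auto simp: not_le)
qed

end

section \<open>Lipschitz estimates up to the boundary\<close>

text \<open>A connected set meeting \<open>S\<close> and its complement meets the frontier, and
  distances add along a segment. The equality clause is what makes closed balls, not just open ones,
  tractable below.\<close>

lemma segment_hits_frontier:
  fixes y z :: "'a::euclidean_space"
  assumes "y \<in> S" "z \<notin> S"
  obtains w where "w \<in> frontier S" "dist y w \<le> dist y z" "dist y w = dist y z \<Longrightarrow> w = z"
proof -
  have "closed_segment y z \<inter> frontier S \<noteq> {}"
    using assms by (intro connected_Int_frontier connected_segment) auto
  then obtain w where w: "w \<in> closed_segment y z" "w \<in> frontier S" by blast
  have "between (y, z) w" using w(1) by (simp add: between_mem_segment)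
  then have "dist y z = dist y w + dist w z" by (simp add: between)
  with w(2) show ?thesis by (intro that[of w]) auto
qed

lemma ball_infdist_frontier_subset:
  fixes y :: "'a::euclidean_space"
  assumes "open S" "y \<in> S" "dist y z < infdist y (frontier S)"
  shows "z \<in> S"
proof (rule ccontr)
  assume "z \<notin> S"
  then obtain w where "w \<in> frontier S" "dist y w \<le> dist y z"
    using segment_hits_frontier[OF assms(2)] by metis
  then show False using infdist_le[of w "frontier S" y] assms(3) by simp
qed

text \<open>A segment leaving the closure would cross the frontier no later than at distance
  \<open>infdist y (frontier S)\<close>. It cannot cross earlier, so the crossing is the end point
  \<open>z\<close> itself, which then lies in the closure after all.\<close>

lemma cball_infdist_frontier_subset:
  fixes y :: "'a::euclidean_space"
  assumes "y \<in> closure S" "dist y z \<le> infdist y (frontier S)"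
  shows "z \<in> closure S"
proof (rule ccontr)
  assume z: "z \<notin> closure S"
  then obtain w where w: "w \<in> frontier (closure S)" "dist y w \<le> dist y z" "dist y w = dist y z \<Longrightarrow> w = z"
    using segment_hits_frontier[OF assms(1)] by metis
  \<comment> \<open>The frontier of the closure can be smaller than that of \<open>S\<close>, for
    instance for a slit domain, but it is always contained in it.\<close>
  have "w \<in> frontier S" using w(1) interior_mono[OF closure_subset, of S]
    by (auto simp: frontier_def)
  then have "dist y z \<le> dist y w" using infdist_le[of w "frontier S" y] assms(2) by simp
  then have "w = z" using w by simp
  moreover have "w \<in> closure S" using \<open>w \<in> frontier S\<close> by (simp add: frontier_def)
  ultimately show False using z by simp
qed

text \<open>Only partial derivatives are available, so \<open>y\<close> and \<open>y + v\<close> are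
  joined by a path changing one coordinate at a time. Its points differ from \<open>y\<close> by
  vectors componentwise dominated by \<open>v\<close>, hence stay in the ball, and each of the
  \<open>DIM('a)\<close> edges costs at most \<open>K * norm v\<close>.\<close>

lemma coordinatewise_lipschitz:
  fixes g :: "'a::euclidean_space \<Rightarrow> real"
  assumes deriv: "\<And>x i. x \<in> ball y r \<Longrightarrow> i \<in> Basis \<Longrightarrow>
      ((\<lambda>h. g (x + h *\<^sub>R i)) has_real_derivative g' i x) (at 0)"
    and bound: "\<And>x i. x \<in> ball y r \<Longrightarrow> i \<in> Basis \<Longrightarrow> \<bar>g' i x\<bar> \<le> K"
    and v: "norm v < r"
  shows "\<bar>g (y + v) - g y\<bar> \<le> real DIM('a) * K * norm v"
proof -
  have "y \<in> ball y r" using v norm_ge_zero[of v] by (simp del: norm_ge_zero)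
  then have K: "0 \<le> K" using bound[OF _ SOME_Basis] abs_ge_zero order_trans by blast
  have "\<bar>g (y + (\<Sum>i\<in>A. (v \<bullet> i) *\<^sub>R i)) - g y\<bar> \<le> real (card A) * (K * norm v)" if "A \<subseteq> Basis" for A
    using finite_subset[OF that finite_Basis] that
  proof (induction A rule: finite_induct)
    case (insert j A)
    let ?p = "y + (\<Sum>i\<in>A. (v \<bullet> i) *\<^sub>R i)"
    have in_ball: "?p + h *\<^sub>R j \<in> ball y r" if "h \<in> closed_segment 0 (v \<bullet> j)" for h
    proof -
      have h: "\<bar>h\<bar> \<le> \<bar>v \<bullet> j\<bar>" using that by (auto simp: closed_segment_eq_real_ivl split: if_splits)
      have "norm ((\<Sum>i\<in>A. (v \<bullet> i) *\<^sub>R i) + h *\<^sub>R j) \<le> norm v"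
      proof (rule norm_le_componentwise)
        fix b :: 'a assume b: "b \<in> Basis"
        have "(\<Sum>i\<in>A. (v \<bullet> i) *\<^sub>R i) \<bullet> b = (\<Sum>i\<in>A. if i = b then v \<bullet> b else 0)"
          unfolding inner_sum_left using b insert.prems
          by (intro sum.cong) (auto simp: inner_Basis)
        also have "\<dots> = (if b \<in> A then v \<bullet> b else 0)"
          using insert.hyps by simp
        finally show "\<bar>((\<Sum>i\<in>A. (v \<bullet> i) *\<^sub>R i) + h *\<^sub>R j) \<bullet> b\<bar> \<le> \<bar>v \<bullet> b\<bar>"
          using b insert.prems insert.hyps h by (auto simp: inner_add_left inner_Basis)
      qed
      moreover have "dist y (?p + h *\<^sub>R j) = norm ((\<Sum>i\<in>A. (v \<bullet> i) *\<^sub>R i) + h *\<^sub>R j)"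
        by (subst dist_commute) (simp add: dist_norm add.assoc)
      ultimately show ?thesis using v by simp
    qed
    have j: "j \<in> Basis" using insert.prems by simp
    have "norm (g (?p + (v \<bullet> j) *\<^sub>R j) - g (?p + 0 *\<^sub>R j)) \<le> K * norm (v \<bullet> j - 0)"
    proof (rule field_differentiable_bound[where S = "closed_segment 0 (v \<bullet> j)"
          and f = "\<lambda>h. g (?p + h *\<^sub>R j)" and f' = "\<lambda>h. g' j (?p + h *\<^sub>R j)"])
      fix h assume h: "h \<in> closed_segment 0 (v \<bullet> j)"
      show "norm (g' j (?p + h *\<^sub>R j)) \<le> K" using bound[OF in_ball[OF h] j] by simp
      \<comment> \<open>The hypothesis gives derivatives at parameter 0 of the line through each
        point; shifting the parameter turns this into the derivative at \<open>h\<close> along one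
        fixed line.\<close>
      have "((\<lambda>k. g (?p + (k + h) *\<^sub>R j)) has_real_derivative g' j (?p + h *\<^sub>R j)) (at 0)"
        using deriv[OF in_ball[OF h] j] by (simp add: algebra_simps)
      then have "((\<lambda>k. g (?p + k *\<^sub>R j)) has_real_derivative g' j (?p + h *\<^sub>R j)) (at h)"
        using DERIV_shift[of "\<lambda>k. g (?p + k *\<^sub>R j)" "g' j (?p + h *\<^sub>R j)" 0 h] by simp
      then show "((\<lambda>k. g (?p + k *\<^sub>R j)) has_real_derivative g' j (?p + h *\<^sub>R j))
          (at h within closed_segment 0 (v \<bullet> j))"
        by (rule has_field_derivative_at_within)
    qed auto
    moreover have "K * \<bar>v \<bullet> j\<bar> \<le> K * norm v"
      using K Basis_le_norm[OF j] by (intro mult_left_mono) auto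
    moreover have "\<bar>g ?p - g y\<bar> \<le> real (card A) * (K * norm v)"
      using insert.IH insert.prems by simp
    moreover have "y + (\<Sum>i\<in>insert j A. (v \<bullet> i) *\<^sub>R i) = ?p + (v \<bullet> j) *\<^sub>R j"
      using insert.hyps by simp
    ultimately have "\<bar>g (y + (\<Sum>i\<in>insert j A. (v \<bullet> i) *\<^sub>R i)) - g y\<bar> \<le> (real (card A) + 1) * (K * norm v)"
      by (simp only: distrib_right) auto
    then show ?case using insert.hyps by (simp add: add.commute)
  qed simp
  from this[of Basis] show ?thesis by (simp add: euclidean_representation mult.assoc)
qed

text \<open>No derivative is assumed at the frontier point. The estimate is proved on the half-open
  segment, which lies in the open ball inside \<open>D\<close>, and passes to its end by continuity
  of \<open>g\<close> on the closure.\<close>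

lemma lipschitz_to_nearest_frontier_point:
  fixes g :: "'a::euclidean_space \<Rightarrow> real"
  assumes D: "open D" and cont: "continuous_on (closure D) g"
    and diff: "\<And>x i. x \<in> D \<Longrightarrow> i \<in> Basis \<Longrightarrow> (\<lambda>h. g (x + h *\<^sub>R i)) differentiable (at 0)"
    and bound: "\<And>x i. x \<in> D \<Longrightarrow> i \<in> Basis \<Longrightarrow> \<bar>deriv (\<lambda>h. g (x + h *\<^sub>R i)) 0\<bar> \<le> K"
    and y: "y \<in> D" and z: "z \<in> frontier D" "dist y z = infdist y (frontier D)"
  shows "\<bar>g y - g z\<bar> \<le> real DIM('a) * K * dist y z"
proof -
  let ?v = "z - y" and ?d = "infdist y (frontier D)"
  have K: "0 \<le> K" using bound[OF y SOME_Basis] abs_ge_zero order_trans by blast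
  have nv: "norm ?v = ?d" using z by (simp add: dist_norm norm_minus_commute)
  have ball: "ball y ?d \<subseteq> D"
    using ball_infdist_frontier_subset[OF D y] by auto
  have path: "y + \<theta> *\<^sub>R ?v \<in> closure D" if "\<theta> \<in> {0..1}" for \<theta>
  proof (rule cball_infdist_frontier_subset)
    show "y \<in> closure D" using y closure_subset by auto
    show "dist y (y + \<theta> *\<^sub>R ?v) \<le> ?d"
      using that nv by (simp add: dist_norm mult_left_le_one_le infdist_nonneg)
  qed
  \<comment> \<open>An open set misses its frontier. The resulting positive distance gives the
    strict inclusion in the open ball for parameters below 1.\<close>
  have "z \<noteq> y" using y z D by (auto simp: frontier_def interior_open)
  then have d: "0 < ?d" using nv by (metis norm_le_zero_iff not_le right_minus_eq)
  have "\<bar>g (y + \<theta> *\<^sub>R ?v) - g y\<bar> \<le> real DIM('a) * K * dist y z" if "\<theta> \<in> {0..<1}" for \<theta>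
  proof -
    have "\<bar>g (y + \<theta> *\<^sub>R ?v) - g y\<bar> \<le> real DIM('a) * K * norm (\<theta> *\<^sub>R ?v)"
    proof (rule coordinatewise_lipschitz[where r = ?d])
      show "norm (\<theta> *\<^sub>R ?v) < ?d" using that nv d by simp
      fix x i :: 'a assume "x \<in> ball y ?d" and i: "i \<in> Basis"
      then have x: "x \<in> D" using ball by auto
      show "((\<lambda>h. g (x + h *\<^sub>R i)) has_real_derivative deriv (\<lambda>h. g (x + h *\<^sub>R i)) 0) (at 0)"
        using diff[OF x i] by (simp add: DERIV_deriv_iff_real_differentiable)
      show "\<bar>deriv (\<lambda>h. g (x + h *\<^sub>R i)) 0\<bar> \<le> K" by (rule bound[OF x i])
    qed
    also have "\<dots> \<le> real DIM('a) * K * dist y z"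
      using that K nv z(2) d by (intro mult_left_mono) (auto simp: mult_left_le_one_le)
    finally show ?thesis .
  qed
  moreover have "continuous_on (closure {0..<1::real}) (\<lambda>\<theta>. \<bar>g (y + \<theta> *\<^sub>R ?v) - g y\<bar>)"
    by (intro continuous_intros continuous_on_compose2[OF cont]) (use path in auto)
  moreover have "(1::real) \<in> closure {0..<1}" by (simp add: closure_atLeastLessThan)
  ultimately have "\<bar>g (y + 1 *\<^sub>R ?v) - g y\<bar> \<le> real DIM('a) * K * dist y z"
    by (rule continuous_le_on_closure[rotated 2])
  then show ?thesis by (simp add: abs_minus_commute)
qed

section \<open>The random walk on heat balls\<close>

lemma heat_psi_nonneg: "0 \<le> heat_psi d s"
proof (cases "0 < s \<and> s < 1")
  case True
  then have "0 \<le> s * (real d / 2 * (- ln s))" by (intro mult_nonneg_nonneg) auto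
  with True show ?thesis by (simp add: heat_psi_def ln_powr)
qed (auto simp: heat_psi_def)

text \<open>The maximum of \<open>- s * ln s\<close> is \<open>1 / e\<close>, attained at \<open>s = 1 / e\<close>.\<close>

lemma heat_psi_square_le: "(heat_psi d s)\<^sup>2 \<le> real d / (2 * exp 1)"
proof (cases "0 < s \<and> s < 1")
  case True
  have "ln (1 / (exp 1 * s)) \<le> 1 / (exp 1 * s) - 1"
    using True by (intro ln_le_minus_one) simp
  then have "- ln s \<le> 1 / (exp 1 * s)"
    using True by (simp add: ln_div ln_mult)
  then have "s * (- ln s) \<le> s * (1 / (exp 1 * s))"
    using True by (intro mult_left_mono) auto
  then have le: "s * (- ln s) \<le> 1 / exp 1" using True by simp
  have ln: "ln (s powr (- (real d / 2))) = real d / 2 * (- ln s)"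
    using True by (simp add: ln_powr)
  have "0 \<le> s * ln (s powr (- (real d / 2)))"
    unfolding ln using True by (intro mult_nonneg_nonneg) auto
  then have "(heat_psi d s)\<^sup>2 = real d / 2 * (s * (- ln s))"
    using True ln by (simp add: heat_psi_def)
  also have "\<dots> \<le> real d / 2 * (1 / exp 1)"
    by (intro mult_left_mono le) simp
  finally show ?thesis by simp
qed (auto simp: heat_psi_def)

lemma heat_R_nonneg: "0 \<le> heat_R d y g"
  by (simp add: heat_R_def)

text \<open>For positive \<open>d\<close> the coefficient of the squared Gaussian is 0 when
  \<open>d\<close> is even and \<open>1 / d\<close> when it is odd, so the exponential never exceeds
  1. For \<open>d = 0\<close> the convention for division by zero makes the coefficient 1.\<close>

lemma heat_R_le_1:
  assumes "y \<in> PiE {..<d div 2 + 1} (\<lambda>_. {0..1})"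
  shows "heat_R d y g \<le> 1"
proof -
  have y: "0 \<le> y i" "y i \<le> 1" if "i < d div 2 + 1" for i
    using assms that by (auto simp: PiE_iff)
  have "0 \<le> (\<Prod>i<d div 2 + 1. y i)" "(\<Prod>i<d div 2 + 1. y i) \<le> 1"
    using y by (auto intro!: prod_nonneg prod_le_1 simp del: prod.lessThan_Suc)
  then have "(\<Prod>i<d div 2 + 1. y i) powr (2 / real d) \<le> 1"
    by (intro powr_le1) auto
  moreover have "real (d div 2) \<le> real d / 2"
    using of_nat_div_le_of_nat[of d 2, where 'a = real] by simp
  then have "2 / real d * real (d div 2) \<le> 1"
    by (cases "d = 0") (simp_all add: field_simps)
  then have "exp (- (1 - 2 / real d * real (d div 2)) * g\<^sup>2) \<le> 1"
    by (simp add: mult_nonpos_nonneg)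
  ultimately show ?thesis
    unfolding heat_R_def by (intro mult_le_one) auto
qed

section \<open>One step of the walk as a map on space-time\<close>

definition heat_step :: "'a::euclidean_space set \<Rightarrow> real \<times> 'a \<Rightarrow> (nat \<Rightarrow> real) \<times> real \<times> 'a \<Rightarrow> real \<times> 'a" where
  "heat_step D q w =
     (let a = heat_alpha D (fst q) (snd q); r = heat_R DIM('a) (fst w) (fst (snd w))
      in (fst q - a * r, snd q + (2 * sqrt a * heat_psi DIM('a) r) *\<^sub>R snd (snd w)))"

lemma fst_heat_step:
  fixes D :: "'a::euclidean_space set"
  shows "fst (heat_step D q w) =
    fst q - heat_alpha D (fst q) (snd q) * heat_R DIM('a) (fst w) (fst (snd w))"
  by (simp add: heat_step_def Let_def)

lemma heat_walk_eq_chain: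
  "heat_walk D U G V t x \<omega> n = chain (heat_step D) (t, x) (\<lambda>n. (U n \<omega>, G n \<omega>, V n \<omega>)) n"
  by (induction n) (simp_all add: heat_step_def case_prod_beta Let_def)

definition noise_space :: "((nat \<Rightarrow> real) \<times> real \<times> 'a::euclidean_space) measure" where
  "noise_space = PiM {..<DIM('a) div 2 + 1} (\<lambda>_. lborel) \<Otimes>\<^sub>M (borel \<Otimes>\<^sub>M borel)"

text \<open>The noise lies in this set at every sample point, so invariance of the closed cylinder
  holds surely and not just almost surely.\<close>

definition noise_values :: "((nat \<Rightarrow> real) \<times> real \<times> 'a::euclidean_space) set" where
  "noise_values = PiE {..<DIM('a) div 2 + 1} (\<lambda>_. {0..1}) \<times> UNIV \<times> sphere 0 1"

lemma measurable_heat_R [measurable]: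
  "(\<lambda>w. heat_R DIM('a) (fst w) (fst (snd w))) \<in> borel_measurable (noise_space :: (_ \<times> _ \<times> 'a::euclidean_space) measure)"
proof -
  have [measurable]: "(\<lambda>w. fst w i) \<in> borel_measurable (noise_space :: (_ \<times> _ \<times> 'a) measure)"
    if "i < DIM('a) div 2 + 1" for i
  proof -
    have "(\<lambda>y. y i) \<in> PiM {..<DIM('a) div 2 + 1} (\<lambda>_. lborel) \<rightarrow>\<^sub>M (lborel :: real measure)"
      using that by (intro measurable_component_singleton) simp
    then have "(\<lambda>y. y i) \<in> borel_measurable (PiM {..<DIM('a) div 2 + 1} (\<lambda>_. lborel :: real measure))"
      by simp
    then show ?thesis unfolding noise_space_def by (rule measurable_compose[OF measurable_fst])
  qed
  have [measurable]: "(\<lambda>w. fst (snd w)) \<in> borel_measurable (noise_space :: (_ \<times> _ \<times> 'a) measure)"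
    unfolding noise_space_def by measurable
  have "(\<lambda>w. \<Prod>i<DIM('a) div 2 + 1. fst w i) \<in> borel_measurable (noise_space :: (_ \<times> _ \<times> 'a) measure)"
    by (rule borel_measurable_prod) simp
  then show ?thesis
    unfolding heat_R_def by measurable
qed

lemma measurable_fst_borel [measurable]: "fst \<in> borel_measurable (borel :: ('a::second_countable_topology \<times> 'b::second_countable_topology) measure)"
  by (intro borel_measurable_continuous_onI continuous_intros)

lemma measurable_snd_borel [measurable]: "snd \<in> borel_measurable (borel :: ('a::second_countable_topology \<times> 'b::second_countable_topology) measure)"
  by (intro borel_measurable_continuous_onI continuous_intros)

lemma measurable_heat_alpha [measurable]:
  "(\<lambda>q. heat_alpha D (fst q) (snd q)) \<in> borel_measurable (borel :: (real \<times> 'a::euclidean_space) measure)"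
  unfolding heat_alpha_def by (intro borel_measurable_continuous_onI continuous_intros)

lemma measurable_heat_psi [measurable]: "heat_psi d \<in> borel_measurable borel"
  unfolding heat_psi_def by measurable

lemma measurable_heat_step:
  "case_prod (heat_step D) \<in> borel \<Otimes>\<^sub>M noise_space \<rightarrow>\<^sub>M (borel :: (real \<times> 'a::euclidean_space) measure)"
proof -
  have [measurable]: "(\<lambda>w. snd (snd w)) \<in> borel_measurable (noise_space :: (_ \<times> _ \<times> 'a) measure)"
    unfolding noise_space_def by measurable
  have [measurable]: "(\<lambda>x. heat_alpha D (fst (fst x)) (snd (fst x))) \<in>
      borel_measurable (borel \<Otimes>\<^sub>M (noise_space :: (_ \<times> _ \<times> 'a) measure))"
    by (rule measurable_compose[OF measurable_fst measurable_heat_alpha])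
  have [measurable]: "(\<lambda>x. heat_R DIM('a) (fst (snd x)) (fst (snd (snd x)))) \<in>
      borel_measurable ((borel :: (real \<times> 'a) measure) \<Otimes>\<^sub>M (noise_space :: (_ \<times> _ \<times> 'a) measure))"
    by (rule measurable_compose[OF measurable_snd measurable_heat_R])
  have [measurable]: "(\<lambda>x. snd (snd (snd x))) \<in>
      borel_measurable ((borel :: (real \<times> 'a) measure) \<Otimes>\<^sub>M (noise_space :: (_ \<times> _ \<times> 'a) measure))"
    by (rule measurable_compose[OF measurable_snd]) measurable
  show ?thesis
    unfolding heat_step_def Let_def case_prod_beta' by (intro borel_measurable_Pair) measurable
qed

text \<open>This is where the constant \<open>e / (2 * d)\<close> in \<open>heat_alpha\<close> comes
  from: the maximum of \<open>heat_psi\<close> squared is \<open>d / (2 * e)\<close>, so the squared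
  step length \<open>4 * a * \<psi>\<^sup>2\<close> is at most the squared distance to the
  frontier.\<close>

lemma heat_step_dist:
  fixes y :: "'a::euclidean_space"
  assumes "0 \<le> s" "w \<in> noise_values"
  shows "dist y (snd (heat_step D (s, y) w)) \<le> infdist y (frontier D)"
proof -
  let ?d = "infdist y (frontier D)"
  define a where "a = heat_alpha D s y"
  define \<psi> where "\<psi> = heat_psi DIM('a) (heat_R DIM('a) (fst w) (fst (snd w)))"
  have a: "0 \<le> a" "a \<le> exp 1 / (2 * real DIM('a)) * ?d\<^sup>2"
    using assms by (auto simp: a_def heat_alpha_def)
  have "(2 * sqrt a * \<psi>)\<^sup>2 = 4 * (a * \<psi>\<^sup>2)"
    using a by (simp add: power_mult_distrib)
  also have "\<dots> \<le> 4 * ((exp 1 / (2 * real DIM('a)) * ?d\<^sup>2) * (real DIM('a) / (2 * exp 1)))"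
    using a heat_psi_square_le by (intro mult_left_mono mult_mono) (auto simp: \<psi>_def)
  also have "\<dots> = ?d\<^sup>2"
  proof -
    have "4 * ((e / (2 * d) * z) * (d / (2 * e))) = z" if "0 < e" "0 < d" for e d z :: real
      using that by (simp add: divide_simps)
    then show ?thesis by simp
  qed
  finally have "2 * sqrt a * \<psi> \<le> ?d" by (rule power2_le_imp_le) (rule infdist_nonneg)
  moreover have "0 \<le> 2 * sqrt a * \<psi>" using a heat_psi_nonneg by (simp add: \<psi>_def)
  moreover have "norm (snd (snd w)) = 1" using assms(2) by (simp add: noise_values_def mem_Times_iff)
  moreover have "snd (heat_step D (s, y) w) = y + (2 * sqrt a * \<psi>) *\<^sub>R snd (snd w)"
    by (simp add: heat_step_def a_def \<psi>_def Let_def)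
  ultimately show ?thesis by (simp add: dist_norm)
qed

text \<open>The cap of \<open>heat_alpha\<close> by the remaining time and
  \<open>heat_R \<le> 1\<close> together prevent the clock from passing 0.\<close>

lemma heat_step_time:
  fixes y :: "'a::euclidean_space"
  assumes "0 \<le> s" "w \<in> noise_values"
  shows "0 \<le> fst (heat_step D (s, y) w)" "fst (heat_step D (s, y) w) \<le> s"
proof -
  let ?a = "heat_alpha D s y" and ?r = "heat_R DIM('a) (fst w) (fst (snd w))"
  have r: "0 \<le> ?r" "?r \<le> 1"
    using assms(2) heat_R_le_1[of "fst w" "DIM('a)"]
    by (simp_all add: noise_values_def mem_Times_iff heat_R_nonneg)
  have a: "0 \<le> ?a" "?a \<le> s" using assms by (auto simp: heat_alpha_def)
  have "?a * ?r \<le> s * 1" using a r by (intro mult_mono) auto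
  then show "0 \<le> fst (heat_step D (s, y) w)" "fst (heat_step D (s, y) w) \<le> s"
    using a r by (simp_all add: heat_step_def Let_def)
qed

text \<open>The closed cylinder is used because the step length bound includes equality, so a step
  is only known to end in the closure.\<close>

lemma heat_step_invariant:
  assumes "q \<in> {0..T} \<times> closure D" "w \<in> noise_values"
  shows "heat_step D q w \<in> {0..T} \<times> closure D"
proof -
  obtain s y where q: "q = (s, y)" by (cases q)
  then have "0 \<le> s" "s \<le> T" "y \<in> closure D" using assms by auto
  then show ?thesis
    using heat_step_dist[of s w y D] heat_step_time[of s w D y] assms(2)
      cball_infdist_frontier_subset[of y D "snd (heat_step D (s, y) w)"]
    by (auto simp: q mem_Times_iff)
qed

section \<open>The noise of the walk and almost sure stopping\<close>

abbreviation unit_cube :: "nat \<Rightarrow> (nat \<Rightarrow> real) set" where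
  "unit_cube k \<equiv> PiE {..<k} (\<lambda>_. {0..1})"

abbreviation cube_space :: "nat \<Rightarrow> (nat \<Rightarrow> real) measure" where
  "cube_space k \<equiv> PiM {..<k} (\<lambda>_. lborel)"

locale heat_noise =
  fixes M :: "'w measure" and U :: "nat \<Rightarrow> 'w \<Rightarrow> nat \<Rightarrow> real" and G :: "nat \<Rightarrow> 'w \<Rightarrow> real"
    and V :: "nat \<Rightarrow> 'w \<Rightarrow> 'a::euclidean_space"
  assumes noise: "heat_walk_noise M U G V"
begin

lemma noise_prob: "prob_space M"
  and noise_U: "prob_space.indep_vars M (\<lambda>_. (cube_space (DIM('a) div 2 + 1))) U UNIV"
    "\<And>n. distr M (cube_space (DIM('a) div 2 + 1)) (U n) = uniform_measure (cube_space (DIM('a) div 2 + 1)) (unit_cube (DIM('a) div 2 + 1))"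
    "\<And>n \<omega>. \<omega> \<in> space M \<Longrightarrow> U n \<omega> \<in> (unit_cube (DIM('a) div 2 + 1))"
  and noise_G: "prob_space.indep_vars M (\<lambda>_. borel) G UNIV"
    "\<And>n. distributed M lborel (G n) std_normal_density"
  and noise_V: "prob_space.indep_vars M (\<lambda>_. borel) V UNIV"
    "\<And>n. distr M borel (V n) = uniform_sphere"
    "\<And>n \<omega>. \<omega> \<in> space M \<Longrightarrow> V n \<omega> \<in> sphere 0 1"
  and noise_indep: "prob_space.indep_sets M
           (\<lambda>j. [sets (vimage_algebra (space M) (\<lambda>\<omega> n. U n \<omega>) (PiM UNIV (\<lambda>_. (cube_space (DIM('a) div 2 + 1))))),
                 sets (vimage_algebra (space M) (\<lambda>\<omega> n. G n \<omega>) (PiM UNIV (\<lambda>_. borel))),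
                 sets (vimage_algebra (space M) (\<lambda>\<omega> n. V n \<omega>) (PiM UNIV (\<lambda>_. borel)))] ! j)
           {..<3}"
  using noise unfolding heat_walk_noise_def Let_def by auto

sublocale restarting_noise M noise_space "\<lambda>n \<omega>. (U n \<omega>, G n \<omega>, V n \<omega>)"
proof -
  interpret prob_space M by (rule noise_prob)
  have rv [measurable]: "U n \<in> M \<rightarrow>\<^sub>M (cube_space (DIM('a) div 2 + 1))" "G n \<in> borel_measurable M" "V n \<in> borel_measurable M" for n
    using noise_U(1) noise_G(1) noise_V(1) by (auto simp: indep_vars_def)
  \<comment> \<open>\<open>distributed\<close> refers to \<open>lborel\<close>, independence to
    \<open>borel\<close>; they have the same measurable sets, so the push-forwards agree.\<close>
  have law_G: "distr M borel (G n) = density lborel std_normal_density" for n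
  proof -
    have "distr M borel (G n) = distr M lborel (G n)" by (rule distr_cong) auto
    then show ?thesis using noise_G(2)[of n] by (simp add: distributed_def)
  qed
  show "restarting_noise M noise_space (\<lambda>n \<omega>. (U n \<omega>, G n \<omega>, V n \<omega>))"
  proof
    show "(\<lambda>\<omega>. (U n \<omega>, G n \<omega>, V n \<omega>)) \<in> M \<rightarrow>\<^sub>M noise_space" for n
      unfolding noise_space_def by measurable
    show "distr M (noise_space \<Otimes>\<^sub>M PiM UNIV (\<lambda>_. noise_space))
        (\<lambda>\<omega>. ((U 0 \<omega>, G 0 \<omega>, V 0 \<omega>), \<lambda>n. (U (Suc n) \<omega>, G (Suc n) \<omega>, V (Suc n) \<omega>))) =
      distr M noise_space (\<lambda>\<omega>. (U 0 \<omega>, G 0 \<omega>, V 0 \<omega>)) \<Otimes>\<^sub>M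
      distr M (PiM UNIV (\<lambda>_. noise_space)) (\<lambda>\<omega> n. (U n \<omega>, G n \<omega>, V n \<omega>))"
      unfolding noise_space_def
      by (rule distr_restart_triple[OF noise_U(1,2) noise_G(1) law_G noise_V(1,2) noise_indep])
  qed
qed

lemma sample_values: "\<omega> \<in> space M \<Longrightarrow> (U n \<omega>, G n \<omega>, V n \<omega>) \<in> noise_values"
  using noise_U(3)[of \<omega> n] noise_V(3)[of \<omega> n] by (simp add: noise_values_def)

text \<open>\<open>heat_R\<close> can vanish only if some coordinate of \<open>U 0\<close> does, and
  the half-open cube \<open>{0<..1}\<close> has the same volume as the closed one. Positivity is
  what makes the time increments add up to infinity.\<close>

lemma AE_heat_R_pos: "AE \<omega> in M. 0 < heat_R DIM('a) (U 0 \<omega>) (G 0 \<omega>)"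
proof -
  interpret product_sigma_finite "\<lambda>_::nat. lborel :: real measure"
    by (simp add: product_sigma_finite_def sigma_finite_lborel)
  define k where "k = DIM('a) div 2 + 1"
  let ?B = "PiE {..<k} (\<lambda>_. {0<..1::real})"
  have B: "?B \<in> sets (cube_space k)" "unit_cube k \<in> sets (cube_space k)"
    by (intro sets_PiM_I_finite; simp)+
  have U0: "U 0 \<in> M \<rightarrow>\<^sub>M cube_space k"
    using noise_U(1)[folded k_def] by (auto simp: indep_vars_def)
  have "unit_cube k \<inter> ?B = ?B"
    unfolding PiE_Int by (intro PiE_cong) auto
  moreover have "emeasure (cube_space k) ?B = 1" "emeasure (cube_space k) (unit_cube k) = 1"
    by (simp_all add: emeasure_PiM)
  ultimately have "emeasure (distr M (cube_space k) (U 0)) ?B = 1"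
    unfolding noise_U(2)[of 0, folded k_def] using B by (simp add: emeasure_uniform_measure)
  then have "prob (U 0 -` ?B \<inter> space M) = 1"
    by (simp add: emeasure_distr[OF U0 B(1)] emeasure_eq_measure)
  then have "AE \<omega> in M. \<omega> \<in> U 0 -` ?B \<inter> space M"
    using measurable_sets[OF U0 B(1)] by (simp add: prob_eq_1)
  then show ?thesis
  proof eventually_elim
    case (elim \<omega>)
    then have "0 < (\<Prod>i<k. U 0 \<omega> i)"
      by (intro prod_pos) (auto simp: PiE_iff)
    then show ?case unfolding heat_R_def k_def[symmetric]
      by (metis mult_pos_pos exp_gt_zero powr_gt_zero less_irrefl)
  qed
qed

lemma AE_heat_chain_hits:
  assumes "0 < \<epsilon>" "0 \<le> t"
  shows "AE \<omega> in M. \<exists>n. chain (heat_step D) (t, x) (sample \<omega>) n \<in> {q. heat_alpha D (fst q) (snd q) \<le> \<epsilon>}"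
proof -
  let ?R = "\<lambda>w :: (nat \<Rightarrow> real) \<times> real \<times> 'a. heat_R DIM('a) (fst w) (fst (snd w))"
  have pos: "\<not> (AE \<omega> in M. ?R (U 0 \<omega>, G 0 \<omega>, V 0 \<omega>) = 0)"
  proof
    assume "AE \<omega> in M. ?R (U 0 \<omega>, G 0 \<omega>, V 0 \<omega>) = 0"
    with AE_heat_R_pos have "AE \<omega> in M. False" by eventually_elim simp
    then show False by simp
  qed
  \<comment> \<open>While the walk avoids the target set, each step spends at least
    \<open>\<epsilon>\<close> times \<open>heat_R\<close>; beyond the threshold
    \<open>t / \<epsilon>\<close> the total would exceed the time \<open>t\<close>
    available.\<close>
  have "AE \<omega> in M. \<exists>n. t / \<epsilon> < (\<Sum>k<n. ?R (U k \<omega>, G k \<omega>, V k \<omega>))"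
    by (rule AE_partial_sums_unbounded[OF measurable_heat_R heat_R_nonneg pos])
  then show ?thesis
  proof (rule AE_mp, intro AE_I2 impI)
    fix \<omega> assume \<omega>: "\<omega> \<in> space M"
    let ?q = "chain (heat_step D) (t, x) (sample \<omega>)"
    assume "\<exists>n. t / \<epsilon> < (\<Sum>k<n. ?R (U k \<omega>, G k \<omega>, V k \<omega>))"
    then obtain n where n: "t / \<epsilon> < (\<Sum>k<n. ?R (U k \<omega>, G k \<omega>, V k \<omega>))" by blast
    show "\<exists>n. ?q n \<in> {q. heat_alpha D (fst q) (snd q) \<le> \<epsilon>}"
    proof (rule ccontr)
      assume "\<not> ?thesis"
      then have large: "\<epsilon> < heat_alpha D (fst (?q k)) (snd (?q k))" for k
        by (auto simp: not_le)
      have time: "0 \<le> fst (?q k)" for k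
      proof (induction k)
        case (Suc k)
        then show ?case
          using heat_step_time(1)[OF Suc sample_values[OF \<omega>], of D "snd (?q k)" k] by simp
      qed (use assms in simp)
      have "fst (?q n) \<le> t - \<epsilon> * (\<Sum>k<n. ?R (U k \<omega>, G k \<omega>, V k \<omega>))" for n
      proof (induction n)
        case (Suc n)
        have "\<epsilon> * heat_R DIM('a) (U n \<omega>) (G n \<omega>) \<le>
            heat_alpha D (fst (?q n)) (snd (?q n)) * heat_R DIM('a) (U n \<omega>) (G n \<omega>)"
          using large[of n] heat_R_nonneg by (intro mult_right_mono) auto
        with Suc show ?case by (simp add: fst_heat_step distrib_left)
      qed simp
      from this[of n] time[of n] have "\<epsilon> * (\<Sum>k<n. ?R (U k \<omega>, G k \<omega>, V k \<omega>)) \<le> t" by linarith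
      with n \<open>0 < \<epsilon>\<close> show False by (simp add: field_simps)
    qed
  qed
qed

end

section \<open>The solution along the stopped walk\<close>

text \<open>The chain lemmas ask for globally bounded Borel functions, whereas the data are
  continuous only on compact sets; extension by zero supplies both properties.\<close>

lemma compact_extension_bounded_measurable:
  fixes g :: "'b::topological_space \<Rightarrow> real"
  assumes "compact S" "S \<in> sets borel" "continuous_on S g"
  shows "(\<lambda>x. indicator S x * g x) \<in> borel_measurable borel"
    and "\<exists>B. \<forall>x. \<bar>indicator S x * g x\<bar> \<le> B"
proof -
  show "(\<lambda>x. indicator S x * g x) \<in> borel_measurable borel"
    using borel_measurable_continuous_on_indicator[OF assms(2,3)] by simp
  have "bounded (g ` S)" using assms by (intro compact_imp_bounded compact_continuous_image)
  then obtain B where "\<And>x. x \<in> S \<Longrightarrow> \<bar>g x\<bar> \<le> B" by (auto simp: bounded_iff)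
  then have "\<bar>indicator S x * g x\<bar> \<le> max B 0" for x
    by (cases "x \<in> S") (auto simp: le_max_iff_disj)
  then show "\<exists>B. \<forall>x. \<bar>indicator S x * g x\<bar> \<le> B" by blast
qed

locale heat_problem = heat_noise M U G V
  for M :: "'w measure" and U :: "nat \<Rightarrow> 'w \<Rightarrow> nat \<Rightarrow> real" and G :: "nat \<Rightarrow> 'w \<Rightarrow> real"
    and V :: "nat \<Rightarrow> 'w \<Rightarrow> 'a::euclidean_space" +
  fixes T :: real and D :: "'a set" and f :: "real \<Rightarrow> 'a \<Rightarrow> real" and f0 :: "'a \<Rightarrow> real"
    and u :: "real \<Rightarrow> 'a \<Rightarrow> real"
  assumes D: "open D" "bounded D"
    and f: "continuous_on ({0..} \<times> frontier D) (\<lambda>(t, x). f t x)"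
    and f0: "continuous_on (closure D) f0"
    and solution: "heat_ibvp_solution T D f f0 u"
    and representation: "\<And>t x. t \<in> {0..T} \<Longrightarrow> x \<in> closure D \<Longrightarrow>
      u t x = expected_data M D f f0 (limit_T D U G V t x) (limit_X D U G V t x)"
begin

abbreviation "K \<equiv> {0..T} \<times> closure D"
abbreviation "walk q \<omega> \<equiv> chain (heat_step D) q (sample \<omega>)"

lemma compact_K: "compact K"
  using D by (simp add: compact_Times compact_closure)

lemma borel_K: "K \<in> sets borel"
  by (intro borel_closed closed_Times closed_atLeastAtMost closed_closure)

lemma continuous_u: "continuous_on K (\<lambda>q. u (fst q) (snd q))"
  using solution by (simp add: heat_ibvp_solution_def case_prod_beta')

lemma u_frontier: "t \<in> {0..T} \<Longrightarrow> x \<in> frontier D \<Longrightarrow> u t x = f t x"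
  and u_initial: "x \<in> D \<Longrightarrow> u 0 x = f0 x"
  using solution by (auto simp: heat_ibvp_solution_def)

section \<open>Bounded Borel extensions of the solution and the data\<close>

definition u_ext :: "real \<times> 'a \<Rightarrow> real" where
  "u_ext q = indicator K q * u (fst q) (snd q)"

lemma measurable_u_ext: "u_ext \<in> borel_measurable borel"
  and bounded_u_ext: "\<exists>B. \<forall>q. \<bar>u_ext q\<bar> \<le> B"
  using compact_extension_bounded_measurable[OF compact_K borel_K continuous_u]
  by (simp_all add: u_ext_def[abs_def])

definition f_ext :: "real \<times> 'a \<Rightarrow> real" where
  "f_ext q = indicator ({0..T} \<times> frontier D) q * f (fst q) (snd q)"

lemma measurable_f_ext: "f_ext \<in> borel_measurable borel"
  and bounded_f_ext: "\<exists>B. \<forall>q. \<bar>f_ext q\<bar> \<le> B"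
proof -
  have "continuous_on ({0..T} \<times> frontier D) (\<lambda>q. f (fst q) (snd q))"
    using f by (auto simp: case_prod_beta' intro: continuous_on_subset)
  moreover have "compact ({0..T} \<times> frontier D)"
    using D by (simp add: compact_Times compact_frontier_bounded)
  moreover have "{0..T} \<times> frontier D \<in> sets borel"
    by (intro borel_closed closed_Times closed_atLeastAtMost frontier_closed)
  ultimately show "f_ext \<in> borel_measurable borel" "\<exists>B. \<forall>q. \<bar>f_ext q\<bar> \<le> B"
    using compact_extension_bounded_measurable[of "{0..T} \<times> frontier D" "\<lambda>q. f (fst q) (snd q)"]
    by (simp_all add: f_ext_def[abs_def])
qed

text \<open>The value of \<^const>\<open>lim\<close> on a divergent sequence. It may lie anywhere, so the initial datum
  has to be kept at this point to represent the integrand of \<open>expected_data\<close> by a Borel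
  function without knowing that the walk converges.\<close>

definition no_limit :: 'a where
  "no_limit = (THE l. False)"

text \<open>The second summand leaves out \<open>closure D\<close>: on \<open>D\<close> the datum is
  already counted, and on the frontier \<open>expected_data\<close> assigns \<open>f0\<close> the
  weight zero.\<close>

definition f0_ext :: "'a \<Rightarrow> real" where
  "f0_ext y = indicator D y * f0 y + indicator ({no_limit} - closure D) y * f0 no_limit"

lemma measurable_f0_ext: "f0_ext \<in> borel_measurable borel"
  and bounded_f0_ext: "\<exists>B. \<forall>y. \<bar>f0_ext y\<bar> \<le> B"
proof -
  have D_sets: "D \<in> sets borel" using D by simp
  have "continuous_on D f0" using f0 closure_subset continuous_on_subset by blast
  then have [measurable]: "(\<lambda>y. indicator D y * f0 y) \<in> borel_measurable borel"
    using borel_measurable_continuous_on_indicator[OF D_sets, of f0] by simp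
  have [measurable]: "{no_limit} - closure D \<in> sets borel" by auto
  show "f0_ext \<in> borel_measurable borel"
    unfolding f0_ext_def[abs_def] by measurable
  obtain B where B: "\<And>y. \<bar>indicator (closure D) y * f0 y\<bar> \<le> B"
    using compact_extension_bounded_measurable(2)[of "closure D" f0] D f0
    by (auto simp: compact_closure)
  have "\<bar>f0_ext y\<bar> \<le> \<bar>B\<bar> + \<bar>f0 no_limit\<bar>" for y
    using B[of y] closure_subset[of D] by (auto simp: f0_ext_def indicator_def split: if_splits)
  then show "\<exists>B. \<forall>y. \<bar>f0_ext y\<bar> \<le> B" by blast
qed

lemma frontier_cases: "y \<in> closure D \<Longrightarrow> y \<notin> frontier D \<Longrightarrow> y \<in> D"
  "y \<in> D \<Longrightarrow> y \<notin> frontier D" "y \<in> frontier D \<Longrightarrow> y \<in> closure D"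
  using D by (auto simp: frontier_def interior_open)

lemma f_ext_eq: "s \<in> {0..T} \<Longrightarrow> f s y * indicator (frontier D) y = f_ext (s, y)"
  by (simp add: f_ext_def indicator_def)

lemma f0_ext_eq:
  assumes "y \<in> closure D \<or> y = no_limit"
  shows "f0 y * indicator (- frontier D) y = f0_ext y"
  using assms frontier_cases[of y] closure_subset[of D] by (auto simp: f0_ext_def indicator_def)

lemma integrable_bounded:
  fixes g :: "'w \<Rightarrow> real"
  assumes "g \<in> borel_measurable M" "\<And>\<omega>. \<bar>g \<omega>\<bar> \<le> B"
  shows "integrable M g"
  by (rule integrable_const_bound[where B = B]) (use assms in auto)

text \<open>Both the limit payoff and the stopped payoff become the integral of one bounded Borel
  function of the final state. The alternative \<open>no_limit\<close> is there for sample points at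
  which the position diverges.\<close>

lemma expected_data_eq:
  assumes S [measurable]: "S \<in> borel_measurable M" and Y [measurable]: "Y \<in> borel_measurable M"
    and in_range: "\<And>\<omega>. \<omega> \<in> space M \<Longrightarrow> S \<omega> \<in> {0..T} \<and> (Y \<omega> \<in> closure D \<or> Y \<omega> = no_limit)"
  shows "integrable M (\<lambda>\<omega>. f_ext (S \<omega>, Y \<omega>) + f0_ext (Y \<omega>))"
    and "expected_data M D f f0 S Y = (\<integral>\<omega>. f_ext (S \<omega>, Y \<omega>) + f0_ext (Y \<omega>) \<partial>M)"
proof -
  have "(\<lambda>\<omega>. (S \<omega>, Y \<omega>)) \<in> borel_measurable M" by (rule borel_measurable_Pair) measurable
  then have m: "(\<lambda>\<omega>. f_ext (S \<omega>, Y \<omega>)) \<in> borel_measurable M" "(\<lambda>\<omega>. f0_ext (Y \<omega>)) \<in> borel_measurable M"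
    using measurable_f_ext measurable_f0_ext by (auto intro: measurable_compose)
  have int: "integrable M (\<lambda>\<omega>. f_ext (S \<omega>, Y \<omega>))" "integrable M (\<lambda>\<omega>. f0_ext (Y \<omega>))"
    using m bounded_f_ext bounded_f0_ext integrable_bounded by metis+
  then show "integrable M (\<lambda>\<omega>. f_ext (S \<omega>, Y \<omega>) + f0_ext (Y \<omega>))" by simp
  have "expected_data M D f f0 S Y = (\<integral>\<omega>. f_ext (S \<omega>, Y \<omega>) \<partial>M) + (\<integral>\<omega>. f0_ext (Y \<omega>) \<partial>M)"
    unfolding expected_data_def
    using in_range
    by (intro arg_cong2[where f = "(+)"] Bochner_Integration.integral_cong refl f_ext_eq f0_ext_eq) auto
  then show "expected_data M D f f0 S Y = (\<integral>\<omega>. f_ext (S \<omega>, Y \<omega>) + f0_ext (Y \<omega>) \<partial>M)"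
    using int by simp
qed

text \<open>Written as a function of the noise sequence and not of the sample point, so that the
  first noise can be removed by a shift.\<close>

definition limit_payoff :: "real \<times> 'a \<Rightarrow> (nat \<Rightarrow> (nat \<Rightarrow> real) \<times> real \<times> 'a) \<Rightarrow> real" where
  "limit_payoff q z =
    f_ext (lim (\<lambda>n. fst (chain (heat_step D) q z n)), lim (\<lambda>n. snd (chain (heat_step D) q z n))) +
    f0_ext (lim (\<lambda>n. snd (chain (heat_step D) q z n)))"

text \<open>A sequence and its shift have the same limits, hence the same \<open>lim\<close> even
  when divergent. Thus \<open>limit_payoff\<close> is shift-invariant for all noise sequences
  without exception.\<close>

lemma lim_Suc: "lim (\<lambda>n. X (Suc n)) = lim X" for X :: "nat \<Rightarrow> 'b::t2_space"
  by (simp add: lim_def filterlim_sequentially_Suc)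

lemma walk_in_K:
  assumes "q \<in> K" "\<omega> \<in> space M"
  shows "walk q \<omega> n \<in> K"
  by (rule chain_invariant[where G = noise_values])
    (use assms in \<open>blast intro: sample_values heat_step_invariant\<close>)+

text \<open>The clock is monotone and bounded, so it converges for every sample point. For the
  position only closedness is used, and a divergent path is sent to the default value.\<close>

lemma walk_lim:
  assumes q: "q \<in> K" and \<omega>: "\<omega> \<in> space M"
  shows "lim (\<lambda>n. fst (walk q \<omega> n)) \<in> {0..T}"
    and "lim (\<lambda>n. snd (walk q \<omega> n)) \<in> closure D \<or> lim (\<lambda>n. snd (walk q \<omega> n)) = no_limit"
proof -
  note in_K = walk_in_K[OF q \<omega>]
  have time: "fst (walk q \<omega> n) \<in> {0..T}" for n using in_K[of n] by (auto simp: mem_Times_iff)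
  have "decseq (\<lambda>n. fst (walk q \<omega> n))"
  proof (rule decseq_SucI)
    fix n show "fst (walk q \<omega> (Suc n)) \<le> fst (walk q \<omega> n)"
      using heat_step_time(2)[OF _ sample_values[OF \<omega>], of "fst (walk q \<omega> n)" D "snd (walk q \<omega> n)" n] time[of n]
      by simp
  qed
  then obtain l where l: "(\<lambda>n. fst (walk q \<omega> n)) \<longlonglongrightarrow> l"
    using time by (elim decseq_convergent[where B = 0]) auto
  have "l \<in> {0..T}"
    using closed_sequentially[OF closed_atLeastAtMost _ l] time by blast
  then show "lim (\<lambda>n. fst (walk q \<omega> n)) \<in> {0..T}" using limI[OF l] by simp
  show "lim (\<lambda>n. snd (walk q \<omega> n)) \<in> closure D \<or> lim (\<lambda>n. snd (walk q \<omega> n)) = no_limit"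
  proof (cases "convergent (\<lambda>n. snd (walk q \<omega> n))")
    case True
    then have "(\<lambda>n. snd (walk q \<omega> n)) \<longlonglongrightarrow> lim (\<lambda>n. snd (walk q \<omega> n))"
      by (simp add: convergent_LIMSEQ_iff)
    moreover have "snd (walk q \<omega> n) \<in> closure D" for n using in_K[of n] by (auto simp: mem_Times_iff)
    ultimately show ?thesis by (intro disjI1) (rule closed_sequentially[OF closed_closure])
  next
    case False
    \<comment> \<open>For a divergent sequence the predicate inside \<open>lim\<close> is
      identically false, which is exactly the description defining \<open>no_limit\<close>.\<close>
    then show ?thesis by (simp add: lim_def no_limit_def convergent_def)
  qed
qed

lemma measurable_walk: "(\<lambda>\<omega>. walk q \<omega> n) \<in> borel_measurable M"
proof -
  have "(\<lambda>\<omega>. (q, sample \<omega>)) \<in> M \<rightarrow>\<^sub>M borel \<Otimes>\<^sub>M PiM UNIV (\<lambda>_. noise_space)"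
    by (intro measurable_Pair measurable_sample) simp
  from measurable_compose[OF this measurable_chain[OF measurable_heat_step]] show ?thesis by simp
qed

lemma u_ext_eq_limit_payoff:
  assumes q: "q \<in> K"
  shows "u_ext q = (\<integral>\<omega>. limit_payoff q (sample \<omega>) \<partial>M)"
proof -
  let ?S = "\<lambda>\<omega>. lim (\<lambda>n. fst (walk q \<omega> n))" and ?Y = "\<lambda>\<omega>. lim (\<lambda>n. snd (walk q \<omega> n))"
  have m: "?S \<in> borel_measurable M" "?Y \<in> borel_measurable M"
    by (intro borel_measurable_lim_metric measurable_compose[OF measurable_walk]
        measurable_fst_borel measurable_snd_borel)+
  have "u_ext q = expected_data M D f f0 ?S ?Y"
    using q representation[of "fst q" "snd q"]
    by (simp add: u_ext_def limit_T_def[abs_def] limit_X_def[abs_def] walk_T_def walk_X_def heat_walk_eq_chain mem_Times_iff)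
  also have "\<dots> = (\<integral>\<omega>. limit_payoff q (sample \<omega>) \<partial>M)"
    unfolding limit_payoff_def by (rule expected_data_eq(2)[OF m]) (use walk_lim[OF q] in auto)
  finally show ?thesis .
qed

text \<open>The representation is applied twice, at \<open>q\<close> and at the random point after
  one step; the latter stays in \<open>K\<close>, so the representation is valid there too.\<close>

lemma u_ext_harmonic:
  assumes q: "q \<in> K"
  shows "(\<integral>\<omega>. u_ext (heat_step D q (U 0 \<omega>, G 0 \<omega>, V 0 \<omega>)) \<partial>M) = u_ext q"
proof -
  obtain B1 B2 where B: "\<And>q. \<bar>f_ext q\<bar> \<le> B1" "\<And>y. \<bar>f0_ext y\<bar> \<le> B2"
    using bounded_f_ext bounded_f0_ext by metis
  let ?W = "borel \<Otimes>\<^sub>M PiM UNIV (\<lambda>_. noise_space) :: ((real \<times> 'a) \<times> (nat \<Rightarrow> (nat \<Rightarrow> real) \<times> real \<times> 'a)) measure"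
  have [measurable]: "(\<lambda>x. lim (\<lambda>n. fst (chain (heat_step D) (fst x) (snd x) n))) \<in> borel_measurable ?W"
    "(\<lambda>x. lim (\<lambda>n. snd (chain (heat_step D) (fst x) (snd x) n))) \<in> borel_measurable ?W"
    by (intro borel_measurable_lim_metric measurable_compose[OF measurable_chain[OF measurable_heat_step]]
        measurable_fst_borel measurable_snd_borel)+
  have "case_prod limit_payoff \<in> borel_measurable ?W"
    unfolding limit_payoff_def case_prod_beta'
    by (intro borel_measurable_add measurable_compose[OF _ measurable_f_ext]
        measurable_compose[OF _ measurable_f0_ext] borel_measurable_Pair) measurable
  moreover have "\<bar>limit_payoff q z\<bar> \<le> B1 + B2" for q z
    unfolding limit_payoff_def by (intro order_trans[OF abs_triangle_ineq] add_mono B)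
  moreover have "limit_payoff q z = limit_payoff (heat_step D q (z 0)) (\<lambda>n. z (Suc n))" for q z
    unfolding limit_payoff_def chain_Suc_shift[symmetric]
    using lim_Suc[of "\<lambda>n. fst (chain (heat_step D) q z n)"] lim_Suc[of "\<lambda>n. snd (chain (heat_step D) q z n)"]
    by (simp only:)
  ultimately have "(\<integral>\<omega>. \<integral>\<omega>'. limit_payoff (heat_step D q (U 0 \<omega>, G 0 \<omega>, V 0 \<omega>)) (sample \<omega>') \<partial>M \<partial>M) =
      (\<integral>\<omega>. limit_payoff q (sample \<omega>) \<partial>M)"
    by (intro harmonic_of_shift_invariant[OF measurable_heat_step]) auto
  moreover have "(\<integral>\<omega>. u_ext (heat_step D q (U 0 \<omega>, G 0 \<omega>, V 0 \<omega>)) \<partial>M) =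
      (\<integral>\<omega>. \<integral>\<omega>'. limit_payoff (heat_step D q (U 0 \<omega>, G 0 \<omega>, V 0 \<omega>)) (sample \<omega>') \<partial>M \<partial>M)"
    by (intro Bochner_Integration.integral_cong refl u_ext_eq_limit_payoff heat_step_invariant q sample_values)
  ultimately show ?thesis using u_ext_eq_limit_payoff[OF q] by simp
qed

text \<open>All probability is confined here. The analytic input enters through \<open>near\<close>
  and \<open>early\<close>, which are later supplied once by uniform continuity and once by
  derivative bounds, so one estimate serves both conclusions.\<close>

lemma stop_error:
  assumes \<epsilon>: "0 < \<epsilon>" and t: "t \<in> {0..T}" and x: "x \<in> closure D"
    and Y: "is_stop_X M D U G V \<epsilon> t x Y"
    and near: "\<And>s y z. s \<in> {0..T} \<Longrightarrow> y \<in> closure D \<Longrightarrow> z \<in> frontier D \<Longrightarrow>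
      dist y z = infdist y (frontier D) \<Longrightarrow> (dist y z)\<^sup>2 \<le> 2 * \<epsilon> * real DIM('a) / exp 1 \<Longrightarrow>
      \<bar>u s y - u s z\<bar> \<le> \<eta>"
    and early: "\<And>s y. s \<in> {0..T} \<Longrightarrow> s \<le> \<epsilon> \<Longrightarrow> y \<in> D \<Longrightarrow> \<bar>u s y - u 0 y\<bar> \<le> \<eta>"
  shows "\<bar>u t x - expected_data M D f f0 (stop_T D U G V \<epsilon> t x) Y\<bar> \<le> \<eta>"
proof -
  let ?A = "{q :: real \<times> 'a. heat_alpha D (fst q) (snd q) \<le> \<epsilon>}"
  define Q where "Q \<omega> = walk (t, x) \<omega> (Inf {n. walk (t, x) \<omega> n \<in> ?A})" for \<omega>
  have q: "(t, x) \<in> K" using t x by simp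
  have Q_stop: "fst (Q \<omega>) = walk_T D U G V t x (stop_N D U G V \<epsilon> t x \<omega>) \<omega>"
    "snd (Q \<omega>) = walk_X D U G V t x (stop_N D U G V \<epsilon> t x \<omega>) \<omega>" for \<omega>
    by (simp_all add: Q_def walk_T_def walk_X_def stop_N_def heat_walk_eq_chain)
  have QK: "fst (Q \<omega>) \<in> {0..T}" "snd (Q \<omega>) \<in> closure D" if "\<omega> \<in> space M" for \<omega>
    using walk_in_K[OF q that] unfolding Q_def by (auto simp: mem_Times_iff)
  have hits: "AE \<omega> in M. \<exists>n. walk (t, x) \<omega> n \<in> ?A"
    using AE_heat_chain_hits[OF \<epsilon>, of t D x] t by simp
  have A: "?A \<in> sets borel"
    using measurable_sets[OF measurable_heat_alpha[of D], of "{..\<epsilon>}"]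
    by (simp add: vimage_def atMost_def)
  obtain B where B: "\<And>q. \<bar>u_ext q\<bar> \<le> B" using bounded_u_ext by blast
  note stopped = integral_chain_stopped[OF measurable_heat_step measurable_u_ext B _ sample_values
      heat_step_invariant u_ext_harmonic q A hits, folded Q_def]
  have Q_m: "Q \<in> borel_measurable M" and Q_int: "(\<integral>\<omega>. u_ext (Q \<omega>) \<partial>M) = u_ext (t, x)"
    using stopped by auto
  have [measurable]: "(\<lambda>\<omega>. fst (Q \<omega>)) \<in> borel_measurable M" "(\<lambda>\<omega>. snd (Q \<omega>)) \<in> borel_measurable M"
    by (rule measurable_compose[OF Q_m], simp)+
  let ?near = "\<lambda>\<omega>. (infdist (snd (Q \<omega>)) (frontier D))\<^sup>2 \<le> 2 * \<epsilon> * real DIM('a) / exp 1"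
  let ?S = "stop_T D U G V \<epsilon> t x"
  have near_eq: "stop_near_boundary D U G V \<epsilon> t x \<omega> \<longleftrightarrow> ?near \<omega>" for \<omega>
    by (simp add: stop_near_boundary_def Q_stop)
  have S_eq: "?S \<omega> = (if ?near \<omega> then fst (Q \<omega>) else 0)" for \<omega>
    by (simp add: stop_T_def near_eq Q_stop)
  have Y_m: "Y \<in> borel_measurable M" using Y by (simp add: is_stop_X_def)
  have Y_near: "Y \<omega> \<in> frontier D \<and> dist (snd (Q \<omega>)) (Y \<omega>) = infdist (snd (Q \<omega>)) (frontier D)"
    if "\<omega> \<in> space M" "?near \<omega>" for \<omega>
    using Y that by (simp add: is_stop_X_def Let_def near_eq Q_stop[symmetric])
  have Y_far: "Y \<omega> = snd (Q \<omega>)" if "\<omega> \<in> space M" "\<not> ?near \<omega>" for \<omega>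
    using Y that by (simp add: is_stop_X_def Let_def near_eq Q_stop[symmetric])
  have far_D: "snd (Q \<omega>) \<in> D" if "\<omega> \<in> space M" "\<not> ?near \<omega>" for \<omega>
  proof (rule frontier_cases(1)[OF QK(2)[OF that(1)]])
    show "snd (Q \<omega>) \<notin> frontier D"
    proof
      assume "snd (Q \<omega>) \<in> frontier D"
      then have "?near \<omega>" using \<epsilon> by simp
      then show False using that by simp
    qed
  qed
  have S_m: "?S \<in> borel_measurable M"
  proof -
    have [measurable]: "(\<lambda>\<omega>. infdist (snd (Q \<omega>)) (frontier D)) \<in> borel_measurable M"
      by (rule measurable_compose[of "\<lambda>\<omega>. snd (Q \<omega>)" _ borel])
        (measurable, intro borel_measurable_continuous_onI continuous_intros)
    show ?thesis unfolding S_eq[abs_def] by measurable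
  qed
  have in_range: "?S \<omega> \<in> {0..T} \<and> (Y \<omega> \<in> closure D \<or> Y \<omega> = no_limit)" if "\<omega> \<in> space M" for \<omega>
    using QK[OF that] Y_near[OF that] Y_far[OF that] t frontier_cases(3)[of "Y \<omega>"]
    by (cases "?near \<omega>") (auto simp: S_eq)
  note expected = expected_data_eq[OF S_m Y_m in_range]
  have int_u: "integrable M (\<lambda>\<omega>. u_ext (Q \<omega>))"
    by (rule integrable_bounded[OF measurable_compose[OF Q_m measurable_u_ext] B])
  let ?diff = "\<lambda>\<omega>. u_ext (Q \<omega>) - (f_ext (?S \<omega>, Y \<omega>) + f0_ext (Y \<omega>))"
  \<comment> \<open>If the walk never enters \<open>?A\<close>, the index defaults to 0 and the
    bound on \<open>heat_alpha\<close> is lost, so the estimate is claimed only almost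
    surely.\<close>
  have AE: "AE \<omega> in M. \<bar>?diff \<omega>\<bar> \<le> \<eta>"
    using hits
  proof (rule AE_mp, intro AE_I2 impI)
    fix \<omega> assume \<omega>: "\<omega> \<in> space M" and hit: "\<exists>n. walk (t, x) \<omega> n \<in> ?A"
    have "Q \<omega> \<in> ?A"
      using Inf_nat_def1[of "{n. walk (t, x) \<omega> n \<in> ?A}"] hit unfolding Q_def by auto
    then have alpha: "heat_alpha D (fst (Q \<omega>)) (snd (Q \<omega>)) \<le> \<epsilon>" by simp
    have u: "u_ext (Q \<omega>) = u (fst (Q \<omega>)) (snd (Q \<omega>))"
      using QK[OF \<omega>] by (simp add: u_ext_def mem_Times_iff)
    have payoff: "f_ext (?S \<omega>, Y \<omega>) + f0_ext (Y \<omega>) =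
        f (?S \<omega>) (Y \<omega>) * indicator (frontier D) (Y \<omega>) + f0 (Y \<omega>) * indicator (- frontier D) (Y \<omega>)"
      using in_range[OF \<omega>] by (simp add: f_ext_eq f0_ext_eq)
    show "\<bar>?diff \<omega>\<bar> \<le> \<eta>"
    proof (cases "?near \<omega>")
      case True
      note Yn = Y_near[OF \<omega> True]
      have "\<bar>u (fst (Q \<omega>)) (snd (Q \<omega>)) - u (fst (Q \<omega>)) (Y \<omega>)\<bar> \<le> \<eta>"
        using True Yn QK[OF \<omega>] by (intro near) auto
      moreover have "u (fst (Q \<omega>)) (Y \<omega>) = f (fst (Q \<omega>)) (Y \<omega>)"
        using QK[OF \<omega>] Yn by (intro u_frontier) auto
      ultimately show ?thesis unfolding u payoff using True Yn by (simp add: S_eq)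
    next
      case False
      \<comment> \<open>The threshold \<open>2 * \<epsilon> * d / e\<close> is equivalent to the
        spatial part of \<open>heat_alpha\<close> being at most \<open>\<epsilon>\<close>. Away from
        the boundary that part is larger, so the minimum must come from the clock.\<close>
      have "\<epsilon> < exp 1 / (2 * real DIM('a)) * (infdist (snd (Q \<omega>)) (frontier D))\<^sup>2"
        using False by (simp add: field_simps)
      then have "fst (Q \<omega>) \<le> \<epsilon>" using alpha by (simp add: heat_alpha_def min_le_iff_disj)
      then have "\<bar>u (fst (Q \<omega>)) (snd (Q \<omega>)) - u 0 (snd (Q \<omega>))\<bar> \<le> \<eta>"
        using QK[OF \<omega>] far_D[OF \<omega> False] by (intro early) auto
      then show ?thesis unfolding u payoff
        using Y_far[OF \<omega> False] far_D[OF \<omega> False] frontier_cases(2)[of "snd (Q \<omega>)"]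
        by (simp add: u_initial)
    qed
  qed
  have int: "integrable M ?diff" using int_u expected(1) by simp
  have diff: "u t x - expected_data M D f f0 ?S Y = (\<integral>\<omega>. ?diff \<omega> \<partial>M)"
    using int_u expected Q_int q by (simp add: u_ext_def)
  have "\<bar>\<integral>\<omega>. ?diff \<omega> \<partial>M\<bar> \<le> (\<integral>\<omega>. \<bar>?diff \<omega>\<bar> \<partial>M)" by (rule integral_abs_bound)
  also have "\<dots> \<le> \<eta>" by (rule integral_le_const[OF integrable_abs[OF int] AE])
  finally show ?thesis unfolding diff .
qed

end

text \<open>Continuity of the derivatives on the open domain does not bound them near the frontier,
  which is where the walk may stop. Therefore uniform convergence is unconditional, while the rate
  is an implication from bounded first derivatives in time and space.\<close>

theorem proposition4p1:
  fixes T :: real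
    and D :: "'a::euclidean_space set"
    and f :: "real \<Rightarrow> 'a \<Rightarrow> real" and f0 :: "'a \<Rightarrow> real"
    and u :: "real \<Rightarrow> 'a \<Rightarrow> real"
    and M :: "'w measure"
    and U :: "nat \<Rightarrow> 'w \<Rightarrow> nat \<Rightarrow> real" and G :: "nat \<Rightarrow> 'w \<Rightarrow> real" and V :: "nat \<Rightarrow> 'w \<Rightarrow> 'a"
    and X\<epsilon> :: "real \<Rightarrow> real \<Rightarrow> 'a \<Rightarrow> 'w \<Rightarrow> 'a"
    and u\<epsilon> :: "real \<Rightarrow> real \<Rightarrow> 'a \<Rightarrow> real"
  assumes "T > 0"
    and "bounded_finitely_connected_domain D"
    and "continuous_on ({0..} \<times> frontier D) (\<lambda>(t, x). f t x)"
    and "continuous_on (closure D) f0"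
    and "\<And>x. x \<in> frontier D \<Longrightarrow> f 0 x = f0 x"
    and "heat_walk_noise M U G V"
    and "unique_heat_ibvp_solution T D f f0 u"
    and "\<And>t x. t \<in> {0..T} \<Longrightarrow> x \<in> closure D \<Longrightarrow>
           u t x = expected_data M D f f0 (limit_T D U G V t x) (limit_X D U G V t x)"
    and "\<And>\<epsilon> t x. \<epsilon> > 0 \<Longrightarrow> t \<in> {0..T} \<Longrightarrow> x \<in> closure D \<Longrightarrow>
           is_stop_X M D U G V \<epsilon> t x (X\<epsilon> \<epsilon> t x)"
    and "\<And>\<epsilon> t x. \<epsilon> > 0 \<Longrightarrow> t \<in> {0..T} \<Longrightarrow> x \<in> closure D \<Longrightarrow>
           u\<epsilon> \<epsilon> t x = expected_data M D f f0 (stop_T D U G V \<epsilon> t x) (X\<epsilon> \<epsilon> t x)"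
  shows "uniform_limit ({0..T} \<times> closure D) (\<lambda>\<epsilon> (t, x). u\<epsilon> \<epsilon> t x) (\<lambda>(t, x). u t x) (at_right 0)
    \<and> (bounded ((\<lambda>(t, x). time_deriv T u t x) ` ({0..T} \<times> D)) \<and>
       (\<forall>i\<in>Basis. bounded ((\<lambda>(t, x). space_deriv i u t x) ` ({0..T} \<times> D)))
       \<longrightarrow> (\<exists>\<kappa>>0. \<exists>\<epsilon>0>0. \<forall>\<epsilon>. 0 < \<epsilon> \<and> \<epsilon> \<le> \<epsilon>0 \<longrightarrow>
             (\<forall>t\<in>{0..T}. \<forall>x\<in>D. \<bar>u t x - u\<epsilon> \<epsilon> t x\<bar> \<le> \<kappa> * sqrt \<epsilon>)))"
proof -
  have D: "open D" "bounded D"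
    using assms(2) by (auto simp: bounded_finitely_connected_domain_def)
  have sol: "heat_ibvp_solution T D f f0 u"
    using assms(7) by (simp add: unique_heat_ibvp_solution_def)
  interpret heat_problem M U G V T D f f0 u
    by unfold_locales (use assms D sol in auto)
  have D_closure: "D \<subseteq> closure D" by (rule closure_subset)
  have error: "\<bar>u t x - u\<epsilon> \<epsilon> t x\<bar> \<le> \<eta>"
    if "0 < \<epsilon>" "t \<in> {0..T}" "x \<in> closure D"
      "\<And>s y z. s \<in> {0..T} \<Longrightarrow> y \<in> closure D \<Longrightarrow> z \<in> frontier D \<Longrightarrow>
        dist y z = infdist y (frontier D) \<Longrightarrow> (dist y z)\<^sup>2 \<le> 2 * \<epsilon> * real DIM('a) / exp 1 \<Longrightarrow>
        \<bar>u s y - u s z\<bar> \<le> \<eta>"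
      "\<And>s y. s \<in> {0..T} \<Longrightarrow> s \<le> \<epsilon> \<Longrightarrow> y \<in> D \<Longrightarrow> \<bar>u s y - u 0 y\<bar> \<le> \<eta>" for \<epsilon> t x \<eta>
    using stop_error[OF that(1-3) assms(9)[OF that(1-3)], of \<eta>] that(4,5) assms(10)[OF that(1-3)]
    by simp
  have "uniform_limit K (\<lambda>\<epsilon> (t, x). u\<epsilon> \<epsilon> t x) (\<lambda>(t, x). u t x) (at_right 0)"
    unfolding uniform_limit_iff
  proof (intro allI impI)
    fix e :: real assume e: "0 < e"
    have "uniformly_continuous_on K (\<lambda>q. u (fst q) (snd q))"
      by (rule compact_uniformly_continuous[OF continuous_u compact_K])
    then obtain d where d: "0 < d" and uc: "\<And>p q. p \<in> K \<Longrightarrow> q \<in> K \<Longrightarrow> dist p q < d \<Longrightarrow>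
        \<bar>u (fst p) (snd p) - u (fst q) (snd q)\<bar> < e / 2"
      using e unfolding uniformly_continuous_on_def dist_real_def by (metis half_gt_zero dist_commute)
    define c where "c = 2 * real DIM('a) / exp 1"
    have c: "0 < c" by (simp add: c_def)
    \<comment> \<open>The bound \<open>\<epsilon> < d\<close> controls the shift in time, and
      \<open>c * \<epsilon> < d\<^sup>2\<close> the jump to the boundary, whose square is at most
      \<open>c * \<epsilon>\<close> by the stopping rule.\<close>
    have "eventually (\<lambda>\<epsilon>. \<epsilon> \<in> {0<..<min d (d\<^sup>2 / c)}) (at_right 0)"
      using d c by (intro eventually_at_right_real) simp
    then show "\<forall>\<^sub>F \<epsilon> in at_right 0. \<forall>q\<in>K. dist (case q of (t, x) \<Rightarrow> u\<epsilon> \<epsilon> t x) (case q of (t, x) \<Rightarrow> u t x) < e"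
    proof eventually_elim
      case (elim \<epsilon>)
      then have \<epsilon>: "0 < \<epsilon>" "\<epsilon> < d" "c * \<epsilon> < d\<^sup>2" using c by (auto simp: field_simps)
      have "\<bar>u t x - u\<epsilon> \<epsilon> t x\<bar> \<le> e / 2" if tx: "t \<in> {0..T}" "x \<in> closure D" for t x
      proof (rule error[OF \<epsilon>(1) tx])
        fix s y z assume *: "s \<in> {0..T}" "y \<in> closure D" "z \<in> frontier D"
          "(dist y z)\<^sup>2 \<le> 2 * \<epsilon> * real DIM('a) / exp 1"
        then have "(dist y z)\<^sup>2 \<le> c * \<epsilon>" by (simp add: c_def mult_ac)
        then have "dist y z < d" using \<epsilon>(3) d by (intro power2_less_imp_less[of "dist y z" d]) auto
        then have "dist (s, y) (s, z) < d" by (simp add: dist_Pair_Pair)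
        then show "\<bar>u s y - u s z\<bar> \<le> e / 2"
          using uc[of "(s, y)" "(s, z)"] * frontier_cases(3) by auto
      next
        fix s y assume *: "s \<in> {0..T}" "s \<le> \<epsilon>" "y \<in> D"
        then have "dist (s, y) (0, y) < d" using \<epsilon> by (simp add: dist_Pair_Pair)
        then show "\<bar>u s y - u 0 y\<bar> \<le> e / 2"
          using uc[of "(s, y)" "(0, y)"] * D_closure assms(1) by auto
      qed
      then show ?case using e by (fastforce simp: dist_real_def abs_minus_commute)
    qed
  qed
  moreover have "\<exists>\<kappa>>0. \<exists>\<epsilon>0>0. \<forall>\<epsilon>. 0 < \<epsilon> \<and> \<epsilon> \<le> \<epsilon>0 \<longrightarrow>
      (\<forall>t\<in>{0..T}. \<forall>x\<in>D. \<bar>u t x - u\<epsilon> \<epsilon> t x\<bar> \<le> \<kappa> * sqrt \<epsilon>)"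
    if time_bounded: "bounded ((\<lambda>(t, x). time_deriv T u t x) ` ({0..T} \<times> D))"
      and space_bounded: "\<forall>i\<in>Basis. bounded ((\<lambda>(t, x). space_deriv i u t x) ` ({0..T} \<times> D))"
  proof -
    have C12: "C12_on T D u" using sol by (simp add: heat_ibvp_solution_def)
    obtain A where A: "0 < A" "\<And>t x. t \<in> {0..T} \<Longrightarrow> x \<in> D \<Longrightarrow> \<bar>time_deriv T u t x\<bar> \<le> A"
      using time_bounded unfolding bounded_pos by fastforce
    have "bounded (\<Union>i\<in>Basis. (\<lambda>(t, x). space_deriv i u t x) ` ({0..T} \<times> D))"
      using space_bounded by (intro bounded_UN) auto
    then obtain B where B: "0 < B"
      "\<And>i t x. i \<in> Basis \<Longrightarrow> t \<in> {0..T} \<Longrightarrow> x \<in> D \<Longrightarrow> \<bar>space_deriv i u t x\<bar> \<le> B"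
      unfolding bounded_pos by fastforce
    define c where "c = 2 * real DIM('a) / exp 1"
    have c: "0 < c" by (simp add: c_def)
    \<comment> \<open>\<open>A\<close> pays for replacing the stopping time by 0, where
      \<open>s \<le> \<epsilon> \<le> 1\<close> gives \<open>s \<le> sqrt \<epsilon>\<close>. The
      other term pays for the jump of length at most \<open>sqrt (c * \<epsilon>)\<close> to the
      boundary, with Lipschitz constant \<open>DIM('a) * B\<close>. This is why
      \<open>\<epsilon>0 = 1\<close> works.\<close>
    define \<kappa> where "\<kappa> = A + real DIM('a) * B * sqrt c"
    have \<kappa>: "0 < \<kappa>" using A(1) B(1) c by (auto simp: \<kappa>_def intro!: add_pos_nonneg)
    have "\<bar>u t x - u\<epsilon> \<epsilon> t x\<bar> \<le> \<kappa> * sqrt \<epsilon>" if \<epsilon>: "0 < \<epsilon>" "\<epsilon> \<le> 1" and t: "t \<in> {0..T}" and x: "x \<in> D" for \<epsilon> t x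
    proof (rule error)
      show "0 < \<epsilon>" "t \<in> {0..T}" "x \<in> closure D" using \<epsilon> t x D_closure by auto
      fix s y z assume s: "s \<in> {0..T}" and y: "y \<in> closure D" and z: "z \<in> frontier D"
        and dist: "dist y z = infdist y (frontier D)" "(dist y z)\<^sup>2 \<le> 2 * \<epsilon> * real DIM('a) / exp 1"
      have "dist y z \<le> sqrt (c * \<epsilon>)"
        using dist(2) by (intro real_le_rsqrt) (simp add: c_def mult_ac)
      then have dist_le: "real DIM('a) * B * dist y z \<le> real DIM('a) * B * (sqrt c * sqrt \<epsilon>)"
        using B(1) by (intro mult_left_mono) (auto simp: real_sqrt_mult)
      show "\<bar>u s y - u s z\<bar> \<le> \<kappa> * sqrt \<epsilon>"
      proof (cases "y \<in> D")
        case True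
        have "\<bar>u s y - u s z\<bar> \<le> real DIM('a) * B * dist y z"
        proof (rule lipschitz_to_nearest_frontier_point[OF D(1) _ _ _ True z dist(1)])
          show "continuous_on (closure D) (u s)"
            using continuous_on_compose2[OF continuous_u, of "closure D" "\<lambda>y. (s, y)"] s
            by (simp add: continuous_on_Pair image_subset_iff)
          fix x i :: 'a assume xi: "x \<in> D" "i \<in> Basis"
          show "(\<lambda>h. u s (x + h *\<^sub>R i)) differentiable (at 0)"
            using C12 s xi by (simp add: C12_on_def)
          show "\<bar>deriv (\<lambda>h. u s (x + h *\<^sub>R i)) 0\<bar> \<le> B"
            using B(2)[OF xi(2) s xi(1)] by (simp add: space_deriv_def)
        qed
        also have "\<dots> \<le> real DIM('a) * B * (sqrt c * sqrt \<epsilon>)" by (rule dist_le)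
        also have "\<dots> \<le> \<kappa> * sqrt \<epsilon>"
          using A(1) \<epsilon> by (simp add: \<kappa>_def distrib_right mult_ac)
        finally show ?thesis .
      next
        case False
        \<comment> \<open>At a frontier point the distance to the frontier is 0, so the nearest
          point is \<open>y\<close> itself and there is no error.\<close>
        then have "y \<in> frontier D" using frontier_cases(1) y by blast
        then have "y = z" using dist(1) by simp
        then show ?thesis using \<kappa> \<epsilon> by simp
      qed
    next
      fix s y assume s: "s \<in> {0..T}" "s \<le> \<epsilon>" and y: "y \<in> D"
      \<comment> \<open>The time derivative is taken within \<open>{0..T}\<close>, so the mean value
        bound reaches the initial time, where it is one-sided.\<close>
      have "norm (u s y - u 0 y) \<le> A * norm (s - 0)"
      proof (rule field_differentiable_bound[where S = "{0..T}" and f' = "\<lambda>s. time_deriv T u s y"])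
        fix r assume r: "r \<in> {0..T}"
        have "(\<lambda>s. u s y) differentiable (at r within {0..T})"
          using C12 r y by (simp add: C12_on_def)
        then show "((\<lambda>s. u s y) has_real_derivative time_deriv T u r y) (at r within {0..T})"
          unfolding time_deriv_def
          by (simp add: vector_derivative_works has_real_derivative_iff_has_vector_derivative)
        show "norm (time_deriv T u r y) \<le> A" using A(2)[OF r y] by simp
      qed (use s assms(1) in auto)
      also have "\<dots> \<le> A * sqrt \<epsilon>"
      proof (intro mult_left_mono)
        have "s * s \<le> \<epsilon> * 1" using s \<epsilon> by (intro mult_mono) auto
        then show "norm (s - 0) \<le> sqrt \<epsilon>"
          using s by (intro real_le_rsqrt) (simp add: power2_eq_square)
      qed (use A in simp)
      also have "\<dots> \<le> \<kappa> * sqrt \<epsilon>"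
        using B(1) c \<epsilon> by (intro mult_right_mono) (auto simp: \<kappa>_def)
      finally show "\<bar>u s y - u 0 y\<bar> \<le> \<kappa> * sqrt \<epsilon>" by simp
    qed
    then show ?thesis using \<kappa> by (intro exI[of _ \<kappa>] conjI exI[of _ 1]) auto
  qed
  ultimately show ?thesis by blast
qed

end
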